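(* Let $X$ be a connected graph. Then $X$ is hyperbolic (in the sense of Gromov) if and only if there is some $N$ such that every $18$-bi-Lipschitz embedded cyclic subgraph in $X$ has length at most $N$.
   Context: A connected graph is regarded as a geodesic metric space with all edges of length $1$. An $18$-bi-Lipschitz embedded cyclic subgraph of length $N$ in $X$ is a cycle $\alpha$ in $X$ (a subgraph that is a cyclic graph with $N$ edges) such that for all $x,y\in\alpha$, $\frac{1}{18}d_\alpha(x,y)\le d_X(x,y)\le d_\alpha(x,y)$, where $d_\alpha$ and $d_X$ are the path distances in $\alpha$ and $X$ respectively. *)

theory Defs
  imports Complex_Main
begin

text \<open>A graph is simple and undirected, of arbitrary cardinality, given by its set of vertices
  and its set of two-element edges.\<close>

definition simple_graph :: "'a set \<Rightarrow> 'a set set \<Rightarrow> bool" where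
  "simple_graph V E \<longleftrightarrow> (\<forall>e\<in>E. e \<subseteq> V \<and> card e = 2)"

definition connected_graph :: "'a set \<Rightarrow> 'a set set \<Rightarrow> bool" where
  "connected_graph V E \<longleftrightarrow>
     simple_graph V E \<and> (\<forall>u\<in>V. \<forall>v\<in>V. (u, v) \<in> {(x, y). {x, y} \<in> E}\<^sup>*)"

text \<open>Points of the geometric realization are written in barycentric coordinates:
  \<^term>\<open>edge_point u v t\<close> is the point at distance \<open>t\<close> from \<open>u\<close> on the unit-length edge
  from \<open>u\<close> to \<open>v\<close>, and \<^term>\<open>edge_point v v 0\<close> is the vertex \<open>v\<close>. In particular
  \<open>edge_point u v t = edge_point v u (1 - t)\<close>, and the points of a subgraph are points of the
  ambient graph.\<close>

definition edge_point :: "'a \<Rightarrow> 'a \<Rightarrow> real \<Rightarrow> 'a \<Rightarrow> real" where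
  "edge_point u v t = (\<lambda>w. (1 - t) * of_bool (w = u) + t * of_bool (w = v))"

definition realization :: "'a set \<Rightarrow> 'a set set \<Rightarrow> ('a \<Rightarrow> real) set" where
  "realization V E =
     {edge_point v v 0 | v. v \<in> V} \<union> {edge_point u v t | u v t. {u, v} \<in> E \<and> 0 \<le> t \<and> t \<le> 1}"

text \<open>\<open>pl_path E p q l\<close>: there is a piecewise linear path of length \<open>l\<close> from \<open>p\<close> to \<open>q\<close>, that is,
  a finite concatenation of segments each of which lies in a single closed edge.\<close>

inductive pl_path :: "'a set set \<Rightarrow> ('a \<Rightarrow> real) \<Rightarrow> ('a \<Rightarrow> real) \<Rightarrow> real \<Rightarrow> bool"
  for E where
  refl: "pl_path E p p 0"
| step: "\<lbrakk>{u, v} \<in> E; 0 \<le> s; s \<le> 1; 0 \<le> t; t \<le> 1; pl_path E (edge_point u v t) q l\<rbrakk>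
         \<Longrightarrow> pl_path E (edge_point u v s) q (\<bar>s - t\<bar> + l)"

text \<open>The path metric on the realization. It is only meaningful for points joined by some path,
  since the infimum of the empty set of reals is unspecified.\<close>

definition graph_dist :: "'a set set \<Rightarrow> ('a \<Rightarrow> real) \<Rightarrow> ('a \<Rightarrow> real) \<Rightarrow> real" where
  "graph_dist E p q = Inf {l. pl_path E p q l}"

definition gromov_product :: "('p \<Rightarrow> 'p \<Rightarrow> real) \<Rightarrow> 'p \<Rightarrow> 'p \<Rightarrow> 'p \<Rightarrow> real" where
  "gromov_product d w x y = (d x w + d y w - d x y) / 2"

definition gromov_hyperbolic :: "'p set \<Rightarrow> ('p \<Rightarrow> 'p \<Rightarrow> real) \<Rightarrow> bool" where
  "gromov_hyperbolic M d \<longleftrightarrow>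
     (\<exists>\<delta>\<ge>0. \<forall>w\<in>M. \<forall>x\<in>M. \<forall>y\<in>M. \<forall>z\<in>M.
        gromov_product d w x z \<ge> min (gromov_product d w x y) (gromov_product d w y z) - \<delta>)"

definition cyclic_graph :: "nat \<Rightarrow> 'a set \<Rightarrow> 'a set set \<Rightarrow> bool" where
  "cyclic_graph n V E \<longleftrightarrow>
     3 \<le> n \<and> (\<exists>c. inj_on c {..<n} \<and> V = c ` {..<n} \<and>
                  E = (\<lambda>i. {c i, c (Suc i mod n)}) ` {..<n})"

definition bilipschitz_cyclic_subgraph ::
    "real \<Rightarrow> 'a set \<Rightarrow> 'a set set \<Rightarrow> nat \<Rightarrow> 'a set \<Rightarrow> 'a set set \<Rightarrow> bool" where
  "bilipschitz_cyclic_subgraph K V E n V' E' \<longleftrightarrow>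
     V' \<subseteq> V \<and> E' \<subseteq> E \<and> cyclic_graph n V' E' \<and>
     (\<forall>x\<in>realization V' E'. \<forall>y\<in>realization V' E'.
        1 / K * graph_dist E' x y \<le> graph_dist E x y \<and> graph_dist E x y \<le> graph_dist E' x y)"

end

theory Submission
  imports Defs
begin

text \<open>A hyperbolic graph has no long bi-Lipschitz cycles, because paths joining the ends of a geodesic
  must pass close to its midpoint unless they are exponentially long. Both arcs between opposite
  vertices of a bi-Lipschitz cycle of length \<open>n\<close> come within \<open>O(log n)\<close> of the midpoint of a geodesic,
  so two points at distance of order \<open>n\<close> along the cycle are \<open>O(log n)\<close> apart in the graph
  (\<open>gromov_product_chain\<close>, \<open>hyperbolic_bilipschitz_cycle_bound\<close>).

  For the converse, let \<open>N\<close> bound the lengths of bi-Lipschitz cycles. A longer closed walk has a chord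
  that is shorter than each of the arcs it subtends by a factor of \<open>18\<close>
  (\<open>long_closed_walk_has_short_chord\<close>). Cutting along such chords until all pieces have length at most
  \<open>N\<close> fills a closed walk of length \<open>L\<close> by at most \<open>L powr (3 / 2)\<close> pieces (\<open>subquadratic_filling\<close>): the
  graph satisfies a subquadratic isoperimetric inequality. On the other hand, a loop made of a geodesic
  and a path that avoids a ball of radius \<open>r\<close> around one of its points has area at least of order
  \<open>r\<^sup>2\<close>, by counting crossings of concentric spheres modulo two (\<open>geodesic_detour_long\<close>). If the path
  has length \<open>O(r)\<close>, the two estimates bound \<open>r\<close>.

  This yields the stability of quasigeodesics by the usual argument (\<open>geodesic_near_quasigeodesic\<close>). Applied
  to the concatenation of a geodesic segment with a shortest path to it, it shows that geodesics from \<open>z\<close>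
  to the ends of a geodesic pass near the projection of \<open>z\<close> (\<open>projection_almost_geodesic\<close>). Gromov
  products are then distances to geodesics up to bounded error, and the four-point inequality follows
  (\<open>four_point_vertices\<close>).\<close>

section \<open>The path metric of the realization\<close>

definition vertex_point :: "'a \<Rightarrow> 'a \<Rightarrow> real" where
  "vertex_point v = (\<lambda>w. of_bool (w = v))"

abbreviation adj :: "'a set set \<Rightarrow> ('a \<times> 'a) set" where
  "adj E \<equiv> {(x, y). {x, y} \<in> E}"

lemma edge_point_0 [simp]: "edge_point u v 0 = vertex_point u"
  by (auto simp: edge_point_def vertex_point_def)

lemma edge_point_1 [simp]: "edge_point u v 1 = vertex_point v"
  by (auto simp: edge_point_def vertex_point_def)

lemma edge_point_swap: "edge_point u v t = edge_point v u (1 - t)"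
  by (auto simp: edge_point_def)

lemma vertex_point_apply: "vertex_point u w = (if w = u then 1 else 0)"
  by (simp add: vertex_point_def)

lemma vertex_point_eq_iff [simp]: "vertex_point u = vertex_point v \<longleftrightarrow> u = v"
  by (metis vertex_point_apply zero_neq_one)

lemma edge_point_left: "u \<noteq> v \<Longrightarrow> edge_point u v s u = 1 - s"
  by (simp add: edge_point_def)

lemma edge_point_right: "u \<noteq> v \<Longrightarrow> edge_point u v s v = s"
  by (simp add: edge_point_def)

lemma edge_point_pos: "0 < edge_point u v s a \<Longrightarrow> a \<in> {u, v}"
  by (rule ccontr) (simp add: edge_point_def)

lemma pl_path_nonneg: "pl_path E p q l \<Longrightarrow> 0 \<le> l"
  by (induction rule: pl_path.induct) auto

lemma pl_path_trans: "pl_path E p q l \<Longrightarrow> pl_path E q r m \<Longrightarrow> pl_path E p r (l + m)"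
proof (induction rule: pl_path.induct)
  case (step u v s t q l)
  then show ?case using pl_path.step[of u v E s t r "l + m"] by (metis add.assoc)
qed simp

lemma pl_path_edge:
  assumes "{u, v} \<in> E" "0 \<le> s" "s \<le> 1" "0 \<le> t" "t \<le> 1"
  shows "pl_path E (edge_point u v s) (edge_point u v t) \<bar>s - t\<bar>"
  using pl_path.step[OF assms pl_path.refl] by simp

lemma pl_path_sym: "pl_path E p q l \<Longrightarrow> pl_path E q p l"
proof (induction rule: pl_path.induct)
  case (step u v s t q l)
  then show ?case
    using pl_path_trans[OF step.IH pl_path_edge[of u v E t s]]
    by (metis abs_minus_commute add.commute)
qed (rule pl_path.refl)

lemma pl_path_mono: "pl_path E' p q l \<Longrightarrow> E' \<subseteq> E \<Longrightarrow> pl_path E p q l"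
  by (induction rule: pl_path.induct) (auto intro: pl_path.intros)

lemma pl_path_relpow: "(a, b) \<in> adj E ^^ k \<Longrightarrow> pl_path E (vertex_point a) (vertex_point b) (real k)"
proof (induction k arbitrary: b)
  case 0
  then show ?case by (simp add: pl_path.refl)
next
  case (Suc k)
  then obtain c where c: "(a, c) \<in> adj E ^^ k" "{c, b} \<in> E" by auto
  have "pl_path E (vertex_point c) (vertex_point b) 1"
    using pl_path_edge[OF c(2), of 0 1] by simp
  from pl_path_trans[OF Suc.IH[OF c(1)] this] show ?case by (simp add: add.commute)
qed

lemma graph_dist_le: "pl_path E p q l \<Longrightarrow> graph_dist E p q \<le> l"
  unfolding graph_dist_def
  by (rule cInf_lower) (auto intro!: bdd_belowI[of _ 0] dest: pl_path_nonneg)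

lemma graph_dist_ge:
  assumes "pl_path E p q l" "\<And>l. pl_path E p q l \<Longrightarrow> c \<le> l"
  shows "c \<le> graph_dist E p q"
  unfolding graph_dist_def using assms by (intro cInf_greatest) auto

lemma graph_dist_sym: "graph_dist E p q = graph_dist E q p"
proof -
  have "{l. pl_path E p q l} = {l. pl_path E q p l}" using pl_path_sym by blast
  then show ?thesis by (simp add: graph_dist_def)
qed

lemma graph_dist_triangle:
  assumes "pl_path E p q l" "pl_path E q r m"
  shows "graph_dist E p r \<le> graph_dist E p q + graph_dist E q r"
proof -
  have "graph_dist E p r - a \<le> graph_dist E q r" if a: "pl_path E p q a" for a
  proof (rule graph_dist_ge[OF assms(2)])
    fix b assume "pl_path E q r b"
    then show "graph_dist E p r - a \<le> b"
      using graph_dist_le[OF pl_path_trans[OF a], of r b] by (simp add: algebra_simps)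
  qed
  then have "graph_dist E p r - graph_dist E q r \<le> graph_dist E p q"
    by (intro graph_dist_ge[OF assms(1)]) (simp add: algebra_simps)
  then show ?thesis by simp
qed

lemma pl_path_to_endpoint:
  assumes "{u, v} \<in> E" "u \<noteq> v" "0 \<le> s" "s \<le> 1" "a \<in> {u, v}"
  shows "pl_path E (edge_point u v s) (vertex_point a) (1 - edge_point u v s a)"
proof (cases "a = u")
  case True
  then show ?thesis using pl_path_edge[OF assms(1,3,4), of 0] assms
    by (simp add: edge_point_left)
next
  case False
  then show ?thesis using pl_path_edge[OF assms(1,3,4), of 1] assms
    by (simp add: edge_point_right)
qed

section \<open>Piecewise linear paths versus walks on vertices\<close>

text \<open>A route that leaves \<open>p\<close> along its edge to a vertex \<open>a\<close>, walks to a vertex \<open>b\<close>, and runs along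
  an edge to \<open>q\<close>. In barycentric coordinates an endpoint \<open>a\<close> of an edge through \<open>p\<close> lies at
  distance \<open>1 - p a\<close>. The condition \<open>p a > 0\<close> forces \<open>a\<close> to be an endpoint of every edge
  through \<open>p\<close>: a route in a graph therefore leaves a point of a subgraph through a vertex of the
  subgraph.\<close>

definition vertex_route :: "'a set set \<Rightarrow> ('a \<Rightarrow> real) \<Rightarrow> ('a \<Rightarrow> real) \<Rightarrow> real \<Rightarrow> bool" where
  "vertex_route E p q l \<longleftrightarrow>
     (\<exists>a b k. 0 < p a \<and> 0 < q b \<and> (a, b) \<in> adj E ^^ k \<and> (1 - p a) + real k + (1 - q b) \<le> l)"

text \<open>The first leg may aim at any endpoint of the edge: if the coordinate of \<open>a\<close> vanishes, then the
  starting point is the opposite vertex, and the whole edge counts as one more step of the walk.\<close>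

lemma vertex_route_from_edge:
  assumes e: "{u, v} \<in> E" "u \<noteq> v" "0 \<le> s" "s \<le> 1" and a: "a \<in> {u, v}"
    and "(a, b) \<in> adj E ^^ k" "0 < q b" "(1 - edge_point u v s a) + real k + (1 - q b) \<le> l"
  shows "vertex_route E (edge_point u v s) q l"
proof (cases "0 < edge_point u v s a")
  case True
  then show ?thesis using assms unfolding vertex_route_def by blast
next
  case False
  define a' where "a' = (if a = u then v else u)"
  have 1: "edge_point u v s a = 0" "edge_point u v s a' = 1"
    using False e a by (auto simp: edge_point_def a'_def)
  have "(a', a) \<in> adj E"
    using e a by (auto simp: a'_def insert_commute)
  then have "(a', b) \<in> adj E ^^ Suc k"
    using assms(6) by (rule relpow_Suc_I2)
  then show ?thesis using 1 assms(7,8) unfolding vertex_route_def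
    by (intro exI[of _ a'] exI[of _ b] exI[of _ "Suc k"]) auto
qed

text \<open>A path either stays inside one edge or can be shortened to a route through vertices, since entering
  and leaving the interior of an edge through the same end is a detour. Case splits on the position
  of \<open>p\<close> reduce the induction step to composing one segment with the route of the tail. Requiring
  \<open>p\<close> to be interior in the third alternative determines the edge from \<open>p\<close>.\<close>

lemma pl_path_cases:
  assumes "simple_graph V E" "pl_path E p q l"
  shows "p = q \<or> vertex_route E p q l \<or>
    (\<exists>u v s t. {u, v} \<in> E \<and> 0 < s \<and> s < 1 \<and> 0 \<le> t \<and> t \<le> 1 \<and>
       p = edge_point u v s \<and> q = edge_point u v t \<and> \<bar>s - t\<bar> \<le> l)"
  using assms(2)
proof (induction rule: pl_path.induct)
  case (refl p)
  then show ?case by simp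
next
  case (step u v s t q l)
  let ?p = "edge_point u v s" and ?p' = "edge_point u v t"
  have uv: "u \<noteq> v" using assms(1) step.hyps(1) by (auto simp: simple_graph_def)
  note e = step.hyps(1) uv step.hyps(2,3)
  have l0: "0 \<le> l" using step.hyps(6) by (rule pl_path_nonneg)
  have same_edge: "?case" if t': "0 \<le> t'" "t' \<le> 1" "q = edge_point u v t'" "\<bar>t - t'\<bar> \<le> l" for t'
  proof -
    have le: "\<bar>s - t'\<bar> \<le> \<bar>s - t\<bar> + l" using t' by simp
    consider "0 < s \<and> s < 1" | "s = 0" | "s = 1" using e by linarith
    then show ?thesis
    proof cases
      case 1
      then show ?thesis using e t' le by blast
    next
      case 2
      show ?thesis
      proof (cases "t' = 1")
        case True
        have "vertex_route E ?p q (\<bar>s - t\<bar> + l)"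
          using e by (intro vertex_route_from_edge[of u v E s u v 1])
            (use 2 True le t' in \<open>auto simp: edge_point_def\<close>)
        then show ?thesis by blast
      next
        case False
        have "vertex_route E ?p q (\<bar>s - t\<bar> + l)"
          using e by (intro vertex_route_from_edge[of u v E s u u 0])
            (use 2 False le t' e in \<open>auto simp: edge_point_def\<close>)
        then show ?thesis by blast
      qed
    next
      case 3
      show ?thesis
      proof (cases "t' = 0")
        case True
        have "vertex_route E ?p q (\<bar>s - t\<bar> + l)"
          using e by (intro vertex_route_from_edge[of u v E s v u 1])
            (use 3 True le t' in \<open>auto simp: edge_point_def insert_commute\<close>)
        then show ?thesis by blast
      next
        case False
        have "vertex_route E ?p q (\<bar>s - t\<bar> + l)"
          using e by (intro vertex_route_from_edge[of u v E s v v 0])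
            (use 3 False le t' e in \<open>auto simp: edge_point_def\<close>)
        then show ?thesis by blast
      qed
    qed
  qed
  from step.IH consider "?p' = q" | "vertex_route E ?p' q l"
    | u' v' s' t' where "{u', v'} \<in> E" "0 < s'" "s' < 1" "0 \<le> t'" "t' \<le> 1"
       "?p' = edge_point u' v' s'" "q = edge_point u' v' t'" "\<bar>s' - t'\<bar> \<le> l"
    by blast
  then show ?case
  proof cases
    case 1
    then show ?thesis using same_edge[of t] step.hyps l0 by auto
  next
    case 2
    then obtain a b k where ab: "0 < ?p' a" "0 < q b" "(a, b) \<in> adj E ^^ k"
      "(1 - ?p' a) + real k + (1 - q b) \<le> l"
      unfolding vertex_route_def by blast
    have a: "a \<in> {u, v}" using ab(1) by (rule edge_point_pos)
    have "?p' a \<le> ?p a + \<bar>s - t\<bar>" using a uv by (auto simp: edge_point_def)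
    then have "vertex_route E ?p q (\<bar>s - t\<bar> + l)"
      using ab by (intro vertex_route_from_edge[where q = q, OF e a ab(3,2)]) auto
    then show ?thesis by blast
  next
    case 3
    have uv': "u' \<noteq> v'" using assms(1) 3(1) by (auto simp: simple_graph_def)
    have "0 < ?p' u'" "0 < ?p' v'" using uv' 3(2,3) unfolding 3(6) by (auto simp: edge_point_def)
    then have "u' \<in> {u,v}" "v' \<in> {u,v}" by (blast dest: edge_point_pos)+
    then consider "u' = u" "v' = v" | "u' = v" "v' = u" using uv' by auto
    then show ?thesis
    proof cases
      case 1
      have "s' = t" using fun_cong[OF 3(6), of v] 1 uv by (simp add: edge_point_def)
      then show ?thesis using same_edge[of t'] 3 1 by auto
    next
      case 2
      have "s' = 1 - t" using fun_cong[OF 3(6), of u] 2 uv by (simp add: edge_point_def)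
      then show ?thesis using same_edge[of "1 - t'"] 3 2 by (auto simp: edge_point_swap[of v u])
    qed
  qed
qed

text \<open>Between vertices piecewise linear paths are no shorter than walks, so the path metric restricts to
  the combinatorial distance.\<close>

lemma pl_path_vertices:
  assumes "simple_graph V E" "pl_path E (vertex_point a) (vertex_point b) l"
  shows "\<exists>k. (a, b) \<in> adj E ^^ k \<and> real k \<le> l"
proof -
  consider "vertex_point a = vertex_point b" | "vertex_route E (vertex_point a) (vertex_point b) l"
    | u v s where "{u, v} \<in> E" "0 < s" "s < 1" "vertex_point a = edge_point u v s"
    using pl_path_cases[OF assms] by blast
  then show ?thesis
  proof cases
    case 1
    then have "a = b" by simp
    then show ?thesis using pl_path_nonneg[OF assms(2)] by (intro exI[of _ 0]) auto
  next
    case 2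
    then show ?thesis unfolding vertex_route_def
      by (auto simp: vertex_point_apply split: if_splits)
  next
    case 3
    have "u \<noteq> v" using assms(1) 3(1) by (auto simp: simple_graph_def)
    then show ?thesis using 3(2,3) fun_cong[OF 3(4), of u] fun_cong[OF 3(4), of v]
      by (auto simp: edge_point_left edge_point_right vertex_point_apply split: if_splits)
  qed
qed

section \<open>Edge crossings of walks modulo two\<close>

text \<open>For a symmetric predicate \<open>C\<close> this counts the traversals of edges satisfying \<open>C\<close>. Only the
  parity matters later: it is the value of a mod-2 cochain on the chain carried by a walk.\<close>

fun crossings :: "('a \<Rightarrow> 'a \<Rightarrow> bool) \<Rightarrow> 'a list \<Rightarrow> nat" where
  "crossings C (x # y # xs) = of_bool (C x y) + crossings C (y # xs)"
| "crossings C _ = 0"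

lemma crossings_append:
  "crossings C (xs @ a # ys) = crossings C (xs @ [a]) + crossings C (a # ys)"
proof (induction xs)
  case (Cons x xs)
  then show ?case by (cases xs) auto
qed simp

lemma crossings_rev: "symp C \<Longrightarrow> crossings C (rev xs) = crossings C xs"
proof (induction C xs rule: crossings.induct)
  case (1 C x y xs)
  have "crossings C (rev (x # y # xs)) = crossings C (rev xs @ [y]) + crossings C [y, x]"
    using crossings_append[of C "rev xs" y "[x]"] by simp
  then show ?case using 1 by (auto simp: symp_def)
qed auto

lemma crossings_eq_0:
  "(\<And>u v. u \<in> set xs \<Longrightarrow> v \<in> set xs \<Longrightarrow> \<not> C u v) \<Longrightarrow> crossings C xs = 0"
  by (induction C xs rule: crossings.induct) auto

lemma crossings_map_upt:
  "crossings C (map g [0..<Suc n]) = card {i. i < n \<and> C (g i) (g (Suc i))}"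
proof (induction n)
  case (Suc n)
  have "map g [0..<Suc (Suc n)] = map g [0..<n] @ g n # [g (Suc n)]" by simp
  then have "crossings C (map g [0..<Suc (Suc n)])
      = crossings C (map g [0..<n] @ [g n]) + crossings C [g n, g (Suc n)]"
    by (metis crossings_append)
  also have "map g [0..<n] @ [g n] = map g [0..<Suc n]" by simp
  also have "{i. i < Suc n \<and> C (g i) (g (Suc i))} =
    (if C (g n) (g (Suc n)) then insert n {i. i < n \<and> C (g i) (g (Suc i))}
     else {i. i < n \<and> C (g i) (g (Suc i))})"
    by (auto simp: less_Suc_eq)
  ultimately show ?case using Suc.IH by simp
qed simp

text \<open>A closed walk crosses the boundary of any vertex set an even number of times.\<close>

lemma crossings_boundary_parity:
  "xs \<noteq> [] \<Longrightarrow> even (crossings (\<lambda>u v. P u \<noteq> P v) xs) \<longleftrightarrow> (P (hd xs) \<longleftrightarrow> P (last xs))"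
proof (induction "\<lambda>u v. P u \<noteq> P v" xs rule: crossings.induct)
  case (1 x y xs)
  then show ?case by auto
qed auto

lemma crossings_cong:
  "(\<And>u v. u \<in> set xs \<Longrightarrow> v \<in> set xs \<Longrightarrow> C u v = D u v) \<Longrightarrow> crossings C xs = crossings D xs"
  by (induction C xs rule: crossings.induct) auto

section \<open>Vertex distance, walks and geodesics\<close>

lemma relpow_adj_sym: "(u, v) \<in> adj E ^^ k \<Longrightarrow> (v, u) \<in> adj E ^^ k"
proof (induction k arbitrary: v)
  case (Suc k)
  then obtain w where "(u, w) \<in> adj E ^^ k" "{w, v} \<in> E" by auto
  with Suc.IH have "(w, u) \<in> adj E ^^ k" "(v, w) \<in> adj E" by (auto simp: insert_commute)
  then show ?case by (rule relpow_Suc_I2[rotated])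
qed simp

locale conn_graph =
  fixes V :: "'a set" and E :: "'a set set"
  assumes connected: "connected_graph V E"
begin

lemma simple: "simple_graph V E"
  using connected by (simp add: connected_graph_def)

lemma edge_in_V: "{u, v} \<in> E \<Longrightarrow> u \<in> V \<and> v \<in> V"
  using simple by (auto simp: simple_graph_def)

definition d :: "'a \<Rightarrow> 'a \<Rightarrow> nat" where
  "d u v = (LEAST k. (u, v) \<in> adj E ^^ k)"

lemma d_le: "(u, v) \<in> adj E ^^ k \<Longrightarrow> d u v \<le> k"
  unfolding d_def by (rule Least_le)

lemma relpow_d: "u \<in> V \<Longrightarrow> v \<in> V \<Longrightarrow> (u, v) \<in> adj E ^^ d u v"
  using connected rtrancl_imp_relpow unfolding connected_graph_def d_def
  by (metis (mono_tags, lifting) LeastI)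

lemma d_sym: "d u v = d v u"
  unfolding d_def using relpow_adj_sym by metis

lemma d_refl [simp]: "d u u = 0"
  using d_le[of u u 0] by simp

lemma d_triangle: "u \<in> V \<Longrightarrow> v \<in> V \<Longrightarrow> w \<in> V \<Longrightarrow> d u w \<le> d u v + d v w"
  by (intro d_le) (auto simp: relpow_add intro!: relcompI relpow_d)

lemma d_eq_0: "u \<in> V \<Longrightarrow> v \<in> V \<Longrightarrow> d u v = 0 \<longleftrightarrow> u = v"
  using relpow_d[of u v] by auto

lemma d_edge: "{u, v} \<in> E \<Longrightarrow> d u v \<le> 1"
  by (intro d_le) auto

definition walk :: "'a list \<Rightarrow> bool" where
  "walk xs \<longleftrightarrow> xs \<noteq> [] \<and> set xs \<subseteq> V \<and> successively (\<lambda>u v. {u, v} \<in> E) xs"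

lemma walk_singleton: "u \<in> V \<Longrightarrow> walk [u]"
  by (simp add: walk_def)

lemma walk_V: "walk xs \<Longrightarrow> u \<in> set xs \<Longrightarrow> u \<in> V"
  by (auto simp: walk_def)

lemma walk_join: "walk (xs @ [a]) \<Longrightarrow> walk (a # ys) \<Longrightarrow> walk (xs @ a # ys)"
  by (auto simp: walk_def successively_append_iff)

lemma walk_left: "walk (xs @ a # ys) \<Longrightarrow> walk (xs @ [a])"
  by (auto simp: walk_def successively_append_iff)

lemma walk_right: "walk (xs @ a # ys) \<Longrightarrow> walk (a # ys)"
  by (auto simp: walk_def successively_append_iff)

lemma walk_rev: "walk xs \<Longrightarrow> walk (rev xs)"
  by (auto simp: walk_def insert_commute)

lemma walk_relpow:
  assumes "walk xs" "i \<le> j" "j < length xs"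
  shows "(xs ! i, xs ! j) \<in> adj E ^^ (j - i)"
proof -
  have e: "successively (\<lambda>u v. {u, v} \<in> E) xs \<Longrightarrow> Suc k < length xs \<Longrightarrow> {xs ! k, xs ! Suc k} \<in> E"
    for k and xs :: "'a list"
    by (induction "\<lambda>u v. {u, v} \<in> E" xs arbitrary: k rule: successively.induct)
      (auto simp: nth_Cons split: nat.splits)
  have "i + k < length xs \<Longrightarrow> (xs ! i, xs ! (i + k)) \<in> adj E ^^ k" for k
  proof (induction k)
    case (Suc k)
    then show ?case using e[of xs "i + k"] assms(1)
      by (auto simp: walk_def intro!: relcompI[of _ "xs ! (i + k)"])
  qed simp
  from this[of "j - i"] show ?thesis using assms by simp
qed

lemma walk_d_le:
  assumes "walk xs" "u \<in> set xs" "v \<in> set xs"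
  shows "d u v < length xs"
proof -
  obtain i j where ij: "u = xs ! i" "v = xs ! j" "i < length xs" "j < length xs"
    using assms by (metis in_set_conv_nth)
  show ?thesis
  proof (cases "i \<le> j")
    case True
    then show ?thesis using d_le[OF walk_relpow[OF assms(1) True]] ij by simp
  next
    case False
    then show ?thesis using d_le[OF walk_relpow[OF assms(1), of j i]] ij d_sym[of u v] by simp
  qed
qed

lemma relpow_walk:
  assumes "(u, v) \<in> adj E ^^ k" "u \<in> V"
  shows "\<exists>xs. walk xs \<and> hd xs = u \<and> last xs = v \<and> length xs = Suc k"
  using assms(1)
proof (induction k arbitrary: v)
  case 0
  then show ?case using walk_singleton[OF assms(2)] by (intro exI[of _ "[u]"]) auto
next
  case (Suc k)
  then obtain w where w: "(u, w) \<in> adj E ^^ k" "{w, v} \<in> E" by auto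
  with Suc.IH obtain xs where xs: "walk xs" "hd xs = u" "last xs = w" "length xs = Suc k" by blast
  then show ?case using w edge_in_V[OF w(2)]
    by (intro exI[of _ "xs @ [v]"]) (auto simp: walk_def successively_append_iff)
qed

text \<open>Indexing geodesics by distance from their start makes subsegments and reversals reindexings.\<close>

definition geodesic :: "(nat \<Rightarrow> 'a) \<Rightarrow> nat \<Rightarrow> bool" where
  "geodesic g n \<longleftrightarrow> (\<forall>i\<le>n. g i \<in> V) \<and> (\<forall>i j. i \<le> j \<longrightarrow> j \<le> n \<longrightarrow> d (g i) (g j) = j - i)"

lemma geodesic_V: "geodesic g n \<Longrightarrow> i \<le> n \<Longrightarrow> g i \<in> V"
  by (simp add: geodesic_def)

lemma geodesic_d: "geodesic g n \<Longrightarrow> i \<le> j \<Longrightarrow> j \<le> n \<Longrightarrow> d (g i) (g j) = j - i"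
  by (simp add: geodesic_def)

lemma geodesic_exists:
  assumes "u \<in> V" "v \<in> V"
  shows "\<exists>g. geodesic g (d u v) \<and> g 0 = u \<and> g (d u v) = v"
proof -
  obtain xs where xs: "walk xs" "hd xs = u" "last xs = v" "length xs = Suc (d u v)"
    using relpow_walk[OF relpow_d[OF assms] assms(1)] by blast
  have ne: "xs \<noteq> []" using xs by auto
  have ends: "xs ! 0 = u" "xs ! d u v = v" using xs ne by (auto simp: hd_conv_nth last_conv_nth)
  have inV: "xs ! i \<in> V" if "i \<le> d u v" for i using walk_V[OF xs(1)] that xs(4) by simp
  have le: "d (xs ! i) (xs ! j) \<le> j - i" if "i \<le> j" "j \<le> d u v" for i j
    using walk_relpow[OF xs(1), of i j] that xs(4) d_le by auto
  have "d (xs ! i) (xs ! j) = j - i" if ij: "i \<le> j" "j \<le> d u v" for i j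
    using le[OF ij] le[of 0 i] le[of j "d u v"] ij ends
      d_triangle[of u "xs ! i" v] d_triangle[of "xs ! i" "xs ! j" v] inV[of i] inV[of j] assms
    by auto
  then show ?thesis using inV ends by (intro exI[of _ "\<lambda>i. xs ! i"]) (auto simp: geodesic_def)
qed

lemma geodesic_edge: "geodesic g n \<Longrightarrow> i < n \<Longrightarrow> {g i, g (Suc i)} \<in> E"
  using relpow_d[of "g i" "g (Suc i)"] geodesic_d[of g n i "Suc i"] geodesic_V[of g n] by auto

lemma geodesic_sub: "geodesic g n \<Longrightarrow> a \<le> b \<Longrightarrow> b \<le> n \<Longrightarrow> geodesic (\<lambda>i. g (a + i)) (b - a)"
  by (auto simp: geodesic_def)

lemma geodesic_rev: "geodesic g n \<Longrightarrow> geodesic (\<lambda>i. g (n - i)) n"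
  unfolding geodesic_def
proof (intro conjI allI impI)
  fix i j assume g: "(\<forall>i\<le>n. g i \<in> V) \<and> (\<forall>i j. i \<le> j \<longrightarrow> j \<le> n \<longrightarrow> d (g i) (g j) = j - i)"
    and ij: "i \<le> j" "j \<le> n"
  then have "d (g (n - j)) (g (n - i)) = (n - i) - (n - j)" by simp
  then show "d (g (n - i)) (g (n - j)) = j - i" using ij by (simp add: d_sym)
qed simp

lemma walk_map_upt:
  assumes "\<And>i. i < n \<Longrightarrow> {g i, g (Suc i)} \<in> E" "g n \<in> V"
  shows "walk (map g [0..<Suc n])"
  using assms
proof (induction n)
  case (Suc n)
  then have "walk (map g [0..<Suc n])" using edge_in_V by auto
  then show ?case using Suc.prems by (auto simp: walk_def successively_append_iff)
qed (simp add: walk_def)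

lemma geodesic_walk: "geodesic g n \<Longrightarrow> walk (map g [0..<Suc n])"
  by (intro walk_map_upt geodesic_edge geodesic_V) auto

end

section \<open>Short chords give a subquadratic filling\<close>

text \<open>Cutting a loop of length \<open>p + q\<close> along a chord of length \<open>e\<close> yields loops of lengths \<open>p + e\<close> and
  \<open>q + e\<close>. If the chord is short compared with both arcs, strict convexity of the power \<open>3/2\<close> beats
  the added length: the smaller loop has at most \<open>(3/4)\<^sup>2\<close> of the total length, which saves a quarter of
  its contribution. Any exponent below \<open>2\<close> would serve for the comparison with a quadratic lower
  bound below.\<close>

lemma three_halves_power_cut:
  fixes p q e :: real
  assumes "0 \<le> e" "18 * e \<le> p" "18 * e \<le> q"
  shows "(p + e) * sqrt (p + e) + (q + e) * sqrt (q + e) \<le> (p + q) * sqrt (p + q)"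
proof -
  have *: "(p + e) * sqrt (p + e) + (q + e) * sqrt (q + e) \<le> (p + q) * sqrt (p + q)"
    if "p \<le> q" "0 \<le> e" "18 * e \<le> p" for p q :: real
  proof -
    have "sqrt (p + e) \<le> sqrt ((3 / 4)\<^sup>2 * (p + q))"
      using that by (simp add: power2_eq_square)
    also have "\<dots> = 3 / 4 * sqrt (p + q)" by (simp add: real_sqrt_mult)
    finally have "(p + e) * sqrt (p + e) \<le> (p + e) * (3 / 4 * sqrt (p + q))"
      using that by (intro mult_left_mono) auto
    moreover have "(q + e) * sqrt (q + e) \<le> (q + e) * sqrt (p + q)"
      using that by (intro mult_left_mono) auto
    ultimately have "(p + e) * sqrt (p + e) + (q + e) * sqrt (q + e)
        \<le> (p + e) * (3 / 4 * sqrt (p + q)) + (q + e) * sqrt (p + q)"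
      by (rule add_mono)
    also have "\<dots> = ((p + e) * (3 / 4) + (q + e)) * sqrt (p + q)"
      by (simp only: distrib_right mult.assoc)
    also have "\<dots> \<le> (p + q) * sqrt (p + q)"
    proof (rule mult_right_mono)
      show "(p + e) * (3 / 4) + (q + e) \<le> p + q" using that unfolding distrib_right by linarith
      show "0 \<le> sqrt (p + q)" using that by (intro real_sqrt_ge_zero) linarith
    qed
    finally show ?thesis .
  qed
  show ?thesis
  proof (cases "p \<le> q")
    case True
    then show ?thesis using * assms by blast
  next
    case False
    then show ?thesis using *[of q p] assms by (simp add: add.commute)
  qed
qed

context conn_graph
begin

definition closed_walk :: "'a list \<Rightarrow> bool" where
  "closed_walk xs \<longleftrightarrow> walk xs \<and> hd xs = last xs"

text \<open>The two arcs between \<open>a\<close> and \<open>b\<close> have lengths \<open>length B + 1\<close> and \<open>length A + length C\<close>. A repeated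
  vertex of the walk counts as a chord of length \<open>0\<close>.\<close>

definition has_short_chord :: "'a list \<Rightarrow> bool" where
  "has_short_chord w \<longleftrightarrow> (\<exists>A a B b C s. w = A @ a # B @ b # C \<and> walk s \<and> hd s = a \<and> last s = b \<and>
     18 * (length s - 1) < length B + 1 \<and> 18 * (length s - 1) < length A + length C)"

lemma cut_along_chord:
  assumes w: "closed_walk (A @ a # B @ b # C)" and s: "walk s" "hd s = a" "last s = b"
  shows "closed_walk (a # B @ rev s)" "closed_walk (A @ s @ C)"
    "symp P \<Longrightarrow> crossings P (a # B @ rev s) + crossings P (A @ s @ C)
       = crossings P (A @ a # B @ b # C) + 2 * crossings P s"
proof -
  have s0: "s \<noteq> []" using s by (simp add: walk_def)
  obtain s1 where s1: "s = a # s1" using s s0 by (cases s) auto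
  obtain s2 where s2: "s = s2 @ [b]" using s s0 by (cases s rule: rev_cases) auto
  have w': "walk (A @ a # B @ b # C)" using w by (simp add: closed_walk_def)
  have wA: "walk (A @ [a])" using w' by (rule walk_left)
  have wC: "walk (b # C)" using walk_right[of "A @ a # B" b C] w' by simp
  have wB: "walk (a # B @ [b])" using walk_left[of "a # B" b C] walk_right[of A a "B @ b # C"] w' by simp
  have "walk (b # rev s2)" using walk_rev[OF s(1)] by (simp add: s2)
  with walk_join[of "a # B" b "rev s2"] wB have "walk (a # B @ rev s)" by (simp add: s2)
  moreover have "last (a # B @ rev s) = a" by (simp add: s1)
  ultimately show "closed_walk (a # B @ rev s)" by (simp add: closed_walk_def)
  have "walk (s @ C)" using walk_join[of s2 b C] s(1) wC by (simp add: s2)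
  then have "walk (A @ s @ C)" using walk_join[of A a "s1 @ C"] wA by (simp add: s1)
  moreover have "hd (A @ s @ C) = hd (A @ a # B @ b # C)" by (cases A) (auto simp: s1)
  moreover have "last (A @ s @ C) = last (A @ a # B @ b # C)" by (simp add: s2)
  ultimately show "closed_walk (A @ s @ C)" using w unfolding closed_walk_def by metis
  assume P: "symp P"
  have "crossings P (A @ a # B @ b # C)
      = crossings P (A @ [a]) + (crossings P (a # B @ [b]) + crossings P (b # C))"
    using crossings_append[of P A a "B @ b # C"] crossings_append[of P "a # B" b C] by simp
  moreover have "crossings P (A @ s @ C)
      = crossings P (A @ [a]) + crossings P (s @ C)"
    using crossings_append[of P A a "s1 @ C"] by (simp add: s1)
  moreover have "crossings P (s @ C) = crossings P s + crossings P (b # C)"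
    using crossings_append[of P s2 b C] by (simp add: s2)
  moreover have "crossings P (a # B @ rev s) = crossings P (a # B @ [b]) + crossings P s"
    using crossings_append[of P "a # B" b "rev s2"] crossings_rev[OF P, of s] by (simp add: s2)
  ultimately show "crossings P (a # B @ rev s) + crossings P (A @ s @ C)
       = crossings P (A @ a # B @ b # C) + 2 * crossings P s" by simp
qed

text \<open>If all closed walks of length above \<open>N\<close> have short chords, cut repeatedly until only closed walks of
  length at most \<open>N\<close> remain. Their number is the combinatorial area of \<open>w\<close>, and the sum of the \<open>3/2\<close>
  powers of the lengths does not grow under cutting. Both copies of a chord cancel modulo two, so the
  pieces sum to \<open>w\<close> as mod-2 chains; the last conjunct records this by duality with cochains.\<close>

lemma subquadratic_filling:
  assumes chord: "\<And>w. closed_walk w \<Longrightarrow> N + 1 < length w \<Longrightarrow> has_short_chord w"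
    and "closed_walk w"
  shows "\<exists>Ws. (\<forall>v\<in>set Ws. closed_walk v \<and> length v \<le> N + 1) \<and>
    real (length Ws) \<le> real (length w - 1) * sqrt (real (length w - 1)) \<and>
    (\<forall>P. symp P \<longrightarrow> (\<forall>v\<in>set Ws. even (crossings P v)) \<longrightarrow> even (crossings P w))"
  using assms(2)
proof (induction "length w" arbitrary: w rule: less_induct)
  case less
  show ?case
  proof (cases "N + 1 < length w")
    case False
    show ?thesis
    proof (cases "length w \<le> 1")
      case True
      moreover have "w \<noteq> []" using less.prems by (simp add: closed_walk_def walk_def)
      ultimately obtain u where "w = [u]" by (cases w) auto
      then show ?thesis by (intro exI[of _ "[]"]) auto
    next
      case False
      then have "1 \<le> real (length w - 1)" by simp
      then have "1 * 1 \<le> real (length w - 1) * sqrt (real (length w - 1))"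
        by (intro mult_mono) auto
      then have "real (length [w]) \<le> real (length w - 1) * sqrt (real (length w - 1))"
        by (simp only: list.size)
      moreover have "\<forall>v\<in>set [w]. closed_walk v \<and> length v \<le> N + 1"
        using less.prems \<open>\<not> N + 1 < length w\<close> by simp
      moreover have "\<forall>P. symp P \<longrightarrow> (\<forall>v\<in>set [w]. even (crossings P v)) \<longrightarrow> even (crossings P w)"
        by simp
      ultimately show ?thesis by blast
    qed
  next
    case True
    then obtain A a B b C s where w: "w = A @ a # B @ b # C" and s: "walk s" "hd s = a" "last s = b"
      and short: "18 * (length s - 1) < length B + 1" "18 * (length s - 1) < length A + length C"
      using chord less.prems unfolding has_short_chord_def by blast
    let ?w1 = "a # B @ rev s" and ?w2 = "A @ s @ C"
    note cut = cut_along_chord[OF less.prems[unfolded w] s]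
    define e where "e = length s - 1"
    have ls: "length s = e + 1" using s(1) by (auto simp: walk_def e_def)
    have l: "length ?w1 < length w" "length ?w2 < length w"
      using short by (auto simp: w ls)
    obtain W1 where W1: "\<forall>v\<in>set W1. closed_walk v \<and> length v \<le> N + 1"
      "real (length W1) \<le> real (length ?w1 - 1) * sqrt (real (length ?w1 - 1))"
      "\<And>P. symp P \<Longrightarrow> (\<forall>v\<in>set W1. even (crossings P v)) \<Longrightarrow> even (crossings P ?w1)"
      using less.hyps[OF l(1) cut(1)] by blast
    obtain W2 where W2: "\<forall>v\<in>set W2. closed_walk v \<and> length v \<le> N + 1"
      "real (length W2) \<le> real (length ?w2 - 1) * sqrt (real (length ?w2 - 1))"
      "\<And>P. symp P \<Longrightarrow> (\<forall>v\<in>set W2. even (crossings P v)) \<Longrightarrow> even (crossings P ?w2)"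
      using less.hyps[OF l(2) cut(2)] by blast
    define p q where "p = length B + 1" and "q = length A + length C"
    have len: "length ?w1 - 1 = p + e" "length ?w2 - 1 = q + e" "length w - 1 = p + q"
      by (auto simp: p_def q_def w ls)
    have "18 * real e \<le> real p" "18 * real e \<le> real q"
      using short by (auto simp: p_def q_def ls)
    then have "(real p + real e) * sqrt (real p + real e) + (real q + real e) * sqrt (real q + real e)
        \<le> (real p + real q) * sqrt (real p + real q)"
      by (intro three_halves_power_cut) auto
    then have "real (length (W1 @ W2)) \<le> real (length w - 1) * sqrt (real (length w - 1))"
      using W1(2) W2(2) unfolding len of_nat_add by simp
    moreover have "even (crossings P w)"
      if "symp P" "\<forall>v\<in>set (W1 @ W2). even (crossings P v)" for P
    proof -
      have "even (crossings P ?w1)" "even (crossings P ?w2)" using W1(3) W2(3) that by auto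
      then have "even (crossings P ?w1 + crossings P ?w2)" by simp
      then show ?thesis unfolding cut(3)[OF that(1)] w by simp
    qed
    ultimately show ?thesis using W1(1) W2(1)
      by (intro exI[of _ "W1 @ W2"]) auto
  qed
qed

end

section \<open>Detours around a ball are long\<close>

context conn_graph
begin

text \<open>The two disjuncts are the two orientations of an edge, which makes the predicate a mod-2 cochain.
  The parameters \<open>p\<close> and \<open>\<rho>\<close> serve to separate the two places where a geodesic through \<open>m\<close>
  crosses the sphere of radius \<open>t\<close> around \<open>m\<close>.\<close>

definition sphere_edge :: "'a \<Rightarrow> nat \<Rightarrow> 'a \<Rightarrow> nat \<Rightarrow> 'a \<Rightarrow> 'a \<Rightarrow> bool" where
  "sphere_edge m t p \<rho> u v \<longleftrightarrow>
     d m u \<le> t \<and> t < d m v \<and> d p u \<le> \<rho> \<or> d m v \<le> t \<and> t < d m u \<and> d p v \<le> \<rho>"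

lemma symp_sphere_edge: "symp (sphere_edge m t p \<rho>)"
  by (auto simp: symp_def sphere_edge_def)

text \<open>A closed walk crosses a sphere evenly, so an odd count needs vertices on both sides of the sphere
  and both near and far from \<open>p\<close>. A short closed walk has small diameter, which confines \<open>t\<close> and \<open>\<rho>\<close>
  to intervals of bounded length: each short loop accounts for boundedly many pairs \<open>(t, \<rho>)\<close>.\<close>

lemma odd_sphere_edges:
  assumes v: "closed_walk v" "length v \<le> N + 1" and odd: "odd (crossings (sphere_edge m t p \<rho>) v)"
    and mp: "m \<in> V" "p \<in> V"
  shows "t \<in> {d m (hd v) - N..<d m (hd v) + N}" "\<rho> \<in> {d p (hd v) - N..<d p (hd v) + N}"
proof -
  have walk: "walk v" and ne: "v \<noteq> []" using v by (auto simp: closed_walk_def walk_def)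
  have near: "d x u \<le> d x (hd v) + N" "d x (hd v) \<le> d x u + N" if "u \<in> set v" "x \<in> V" for u x
  proof -
    have h: "hd v \<in> set v" using ne by simp
    have "d (hd v) u \<le> N" using walk_d_le[OF walk h that(1)] v(2) by simp
    then show "d x u \<le> d x (hd v) + N" "d x (hd v) \<le> d x u + N"
      using d_triangle[of x "hd v" u] d_triangle[of x u "hd v"] d_sym[of u "hd v"]
        walk_V[OF walk h] walk_V[OF walk that(1)] that(2) by auto
  qed
  have "\<not> (\<forall>u\<in>set v. \<not> d m u \<le> t)" "\<not> (\<forall>u\<in>set v. d m u \<le> t)" "\<not> (\<forall>u\<in>set v. \<not> d p u \<le> \<rho>)"
    using odd crossings_eq_0[of v "sphere_edge m t p \<rho>"] by (force simp: sphere_edge_def)+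
  then show "t \<in> {d m (hd v) - N..<d m (hd v) + N}"
    using near[OF _ mp(1)] by (force simp: not_le)
  have "\<not> (\<forall>u\<in>set v. d p u \<le> \<rho>)"
  proof
    assume "\<forall>u\<in>set v. d p u \<le> \<rho>"
    then have "crossings (sphere_edge m t p \<rho>) v
        = crossings (\<lambda>x y. (d m x \<le> t) \<noteq> (d m y \<le> t)) v"
      by (intro crossings_cong) (auto simp: sphere_edge_def)
    then show False
      using odd crossings_boundary_parity[OF ne, of "\<lambda>x. d m x \<le> t"] v(1)
      by (simp add: closed_walk_def)
  qed
  with \<open>\<not> (\<forall>u\<in>set v. \<not> d p u \<le> \<rho>)\<close> show "\<rho> \<in> {d p (hd v) - N..<d p (hd v) + N}"
    using near[OF _ mp(2)] by (force simp: not_le)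
qed

text \<open>Quadratic lower bound for the area of the loop formed by a geodesic through \<open>m = g k\<close> and a walk \<open>B\<close>
  that avoids the ball of radius \<open>r\<close> around \<open>m\<close>. For \<open>t < r\<close> the loop crosses the sphere of radius \<open>t\<close>
  exactly twice, at points of the geodesic at distance \<open>2 * t\<close> from each other. For each \<open>\<rho> < 2 * t\<close>
  exactly one of the two crossings is within \<open>\<rho>\<close> of \<open>p = g (k - t)\<close>, so some piece of the filling is
  odd for the pair \<open>(t, \<rho>)\<close>. There are \<open>r * (r - 1)\<close> such pairs, and each piece serves at most
  \<open>(2 * N)\<^sup>2\<close> of them; compare with the number of pieces.\<close>

lemma geodesic_detour_long:
  assumes chord: "\<And>w. closed_walk w \<Longrightarrow> N + 1 < length w \<Longrightarrow> has_short_chord w"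
    and g: "geodesic g n" and k: "k \<le> n"
    and B: "walk B" "hd B = g 0" "last B = g n" "length B \<le> L + 1"
    and far: "\<And>v. v \<in> set B \<Longrightarrow> r \<le> d (g k) v"
  shows "real (r * (r - 1)) \<le> (2 * N)\<^sup>2 * (2 * L * sqrt (2 * L))"
proof -
  define m where "m = g k"
  have B0: "B \<noteq> []" using B by (simp add: walk_def)
  have ends: "g 0 \<in> set B" "g n \<in> set B" using B0 B(2,3) by (metis hd_in_set last_in_set)+
  have r1: "r \<le> k" using far[OF ends(1)] geodesic_d[OF g, of 0 k] k by (simp add: d_sym)
  have r2: "r \<le> n - k" using far[OF ends(2)] geodesic_d[OF g, of k n] k by simp
  have mV: "m \<in> V" using geodesic_V[OF g k] by (simp add: m_def)
  have dm: "d m (g i) = (if i \<le> k then k - i else i - k)" if "i \<le> n" for i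
    using geodesic_d[OF g, of i k] geodesic_d[OF g, of k i] k that d_sym[of m] by (auto simp: m_def)
  obtain B' where B': "rev B = g n # B'"
    using B0 B(3) by (metis hd_rev list.collapse rev_is_Nil_conv)
  define w where "w = map g [0..<n] @ rev B"
  have gw: "map g [0..<n] @ [g n] = map g [0..<Suc n]" by simp
  have "walk w" unfolding w_def B'
    by (rule walk_join) (use gw geodesic_walk[OF g] walk_rev[OF B(1)] B' in auto)
  moreover have "hd w = g 0"
    using B' B0 by (cases "n = 0") (auto simp: w_def hd_map)
  moreover have "last w = g 0" using B0 B(2) by (simp add: w_def last_rev)
  ultimately have cw: "closed_walk w" by (simp add: closed_walk_def)
  have n_le: "n \<le> length B - 1"
    using walk_d_le[OF B(1) ends] geodesic_d[OF g, of 0 n] by simp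
  have lw: "length w - 1 \<le> 2 * L" using n_le B(4) by (simp add: w_def)
  obtain Ws where Ws: "\<forall>v\<in>set Ws. closed_walk v \<and> length v \<le> N + 1"
    "real (length Ws) \<le> real (length w - 1) * sqrt (real (length w - 1))"
    "\<And>P. symp P \<Longrightarrow> (\<forall>v\<in>set Ws. even (crossings P v)) \<Longrightarrow> even (crossings P w)"
    using subquadratic_filling[OF chord cw] by blast
  define T where "T = (SIGMA t:{1..<r}. {..<2 * t})"
  define S where "S v = (SIGMA t:{d m (hd v) - N..<d m (hd v) + N}.
      {d (g (k - t)) (hd v) - N..<d (g (k - t)) (hd v) + N})" for v
  have "T \<subseteq> (\<Union>v\<in>set Ws. S v)"
  proof
    fix z assume "z \<in> T"
    then obtain t \<rho> where z: "z = (t, \<rho>)" and t: "1 \<le> t" "t < r" and \<rho>: "\<rho> < 2 * t"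
      by (auto simp: T_def)
    define p where "p = g (k - t)"
    let ?P = "sphere_edge m t p \<rho>"
    have pV: "p \<in> V" unfolding p_def using geodesic_V[OF g, of "k - t"] k by simp
    have dp: "d p (g (k + t)) = 2 * t"
      unfolding p_def using geodesic_d[OF g, of "k - t" "k + t"] t r1 r2 by auto
    have "?P (g i) (g (Suc i)) \<longleftrightarrow> i = k - Suc t" if i: "i < n" for i
    proof (cases "i < k")
      case True
      have "?P (g i) (g (Suc i)) \<longleftrightarrow> Suc i = k - t \<and> d p (g (Suc i)) \<le> \<rho>"
        unfolding sphere_edge_def using dm[of i] dm[of "Suc i"] True i t r1 by auto
      also have "\<dots> \<longleftrightarrow> Suc i = k - t" by (auto simp: p_def)
      also have "\<dots> \<longleftrightarrow> i = k - Suc t" using t r1 by auto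
      finally show ?thesis .
    next
      case False
      have "?P (g i) (g (Suc i)) \<longleftrightarrow> i = k + t \<and> d p (g i) \<le> \<rho>"
        unfolding sphere_edge_def using dm[of i] dm[of "Suc i"] False i by auto
      then show ?thesis using dp \<rho> t r1 False by auto
    qed
    then have "{i. i < n \<and> ?P (g i) (g (Suc i))} = {k - Suc t}"
      using t r1 k by auto
    then have "crossings ?P (map g [0..<Suc n]) = 1"
      by (simp only: crossings_map_upt) simp
    moreover have "crossings ?P (rev B) = 0"
      using far t by (intro crossings_eq_0) (force simp: sphere_edge_def m_def)
    moreover have "crossings ?P w = crossings ?P (map g [0..<Suc n]) + crossings ?P (rev B)"
      unfolding w_def B' gw[symmetric] by (rule crossings_append)
    ultimately have "odd (crossings ?P w)" by simp
    then obtain v where v: "v \<in> set Ws" "odd (crossings ?P v)"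
      using Ws(3)[OF symp_sphere_edge] by blast
    then have "(t, \<rho>) \<in> S v"
      using odd_sphere_edges[OF _ _ v(2) mV pV] Ws(1) by (auto simp: S_def p_def)
    then show "z \<in> (\<Union>v\<in>set Ws. S v)" using v z by blast
  qed
  moreover have "finite (S v)" for v by (auto simp: S_def)
  ultimately have "card T \<le> card (\<Union>v\<in>set Ws. S v)" by (intro card_mono) auto
  also have "\<dots> \<le> (\<Sum>v\<in>set Ws. card (S v))" by (intro card_UN_le) simp
  also have "\<dots> \<le> (\<Sum>v\<in>set Ws. (2 * N)\<^sup>2)"
  proof (intro sum_mono)
    fix v
    have "card (S v) = (\<Sum>t\<in>{d m (hd v) - N..<d m (hd v) + N}.
        card {d (g (k - t)) (hd v) - N..<d (g (k - t)) (hd v) + N})"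
      unfolding S_def by (intro card_SigmaI) auto
    also have "\<dots> \<le> (\<Sum>t\<in>{d m (hd v) - N..<d m (hd v) + N}. 2 * N)"
      by (intro sum_mono) auto
    also have "\<dots> = card {d m (hd v) - N..<d m (hd v) + N} * (2 * N)" by simp
    also have "\<dots> \<le> (2 * N) * (2 * N)" by (intro mult_le_mono1) simp
    finally show "card (S v) \<le> (2 * N)\<^sup>2" by (simp add: power2_eq_square)
  qed
  also have "\<dots> \<le> length Ws * (2 * N)\<^sup>2" by (simp add: card_length)
  finally have cT: "card T \<le> length Ws * (2 * N)\<^sup>2" .
  have "card T = (\<Sum>t\<in>{1..<r}. 2 * t)"
    unfolding T_def by (subst card_SigmaI) auto
  also have "\<dots> = r * (r - 1)"
    by (induction r) (auto simp: algebra_simps)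
  finally have "real (r * (r - 1)) \<le> real (length Ws) * (2 * N)\<^sup>2"
    using cT by (metis of_nat_le_iff of_nat_mult)
  also have "real (length Ws) \<le> (2 * L) * sqrt (2 * L)"
  proof -
    have "real (length w - 1) * sqrt (real (length w - 1)) \<le> (2 * L) * sqrt (2 * L)"
      using lw by (intro mult_mono) auto
    then show ?thesis using Ws(2) by linarith
  qed
  then have "real (length Ws) * (2 * N)\<^sup>2 \<le> (2 * L * sqrt (2 * L)) * (2 * N)\<^sup>2"
    by (intro mult_right_mono) auto
  finally show ?thesis by (simp add: mult.commute)
qed

end

section \<open>Stability of quasigeodesics and the four-point inequality\<close>

lemma ex_argmax_upto:
  fixes n :: nat
  shows "\<exists>k\<le>n. \<forall>j\<le>n. f j \<le> (f k :: nat)"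
proof -
  have "Max (f ` {..n}) \<in> f ` {..n}" by (intro Max_in) auto
  then obtain k where "Max (f ` {..n}) = f k" "k \<in> {..n}" by (rule imageE)
  then show ?thesis by (metis Max_ge atMost_iff finite_atMost finite_imageI imageI)
qed

lemma ex_argmin_upto:
  fixes n :: nat
  shows "\<exists>k\<le>n. \<forall>j\<le>n. (f k :: nat) \<le> f j"
proof -
  have "Min (f ` {..n}) \<in> f ` {..n}" by (intro Min_in) auto
  then obtain k where "Min (f ` {..n}) = f k" "k \<in> {..n}" by (rule imageE)
  then show ?thesis by (metis Min_le atMost_iff finite_atMost finite_imageI imageI)
qed

lemma ex_last_step: "P 0 \<Longrightarrow> \<not> P n \<Longrightarrow> \<exists>j<n. P j \<and> \<not> P (Suc j)"
  by (induction n) (auto intro: less_SucI)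

context conn_graph
begin

lemma walk_concat:
  assumes "walk xs" "walk ys" "last xs = hd ys"
  shows "walk (xs @ tl ys)" "hd (xs @ tl ys) = hd xs" "last (xs @ tl ys) = last ys"
    "length (xs @ tl ys) = length xs + length ys - 1" "set (xs @ tl ys) \<subseteq> set xs \<union> set ys"
proof -
  obtain y ys' where y: "ys = y # ys'" using assms(2) by (cases ys) (auto simp: walk_def)
  obtain x xs' where x: "xs = xs' @ [x]" using assms(1) by (cases xs rule: rev_cases) (auto simp: walk_def)
  show "walk (xs @ tl ys)" using assms walk_join[of xs' x ys'] by (simp add: x y)
  show "hd (xs @ tl ys) = hd xs" by (cases xs') (auto simp: x)
  show "last (xs @ tl ys) = last ys" using assms(3) by (simp add: x y)
  show "length (xs @ tl ys) = length xs + length ys - 1" by (simp add: y)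
  show "set (xs @ tl ys) \<subseteq> set xs \<union> set ys" by (auto simp: y)
qed

lemma walk_segment:
  assumes "\<And>i. i < l \<Longrightarrow> {b i, b (Suc i)} \<in> E" "\<And>i. i \<le> l \<Longrightarrow> b i \<in> V" "i \<le> l" "j \<le> l"
  shows "\<exists>M. walk M \<and> hd M = b i \<and> last M = b j \<and> length M = (i - j) + (j - i) + 1 \<and> set M \<subseteq> b ` {..l}"
proof -
  have *: "\<exists>M. walk M \<and> hd M = b i \<and> last M = b j \<and> length M = j - i + 1 \<and> set M \<subseteq> b ` {..l}"
    if "i \<le> j" "j \<le> l" for i j
  proof -
    let ?M = "map (\<lambda>k. b (i + k)) [0..<Suc (j - i)]"
    have "walk ?M" using that assms(1)[of "i + _"] assms(2)[of j] by (intro walk_map_upt) auto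
    moreover have "hd ?M = b i" by (simp add: hd_map del: upt_Suc)
    moreover have "last ?M = b j" using that by simp
    moreover have "set ?M \<subseteq> b ` {..l}" using that by (auto simp del: upt_Suc)
    ultimately show ?thesis by (intro exI[of _ ?M]) simp
  qed
  show ?thesis
  proof (cases "i \<le> j")
    case True
    then show ?thesis using *[OF True assms(4)] by simp
  next
    case False
    then obtain M where M: "walk M" "hd M = b j" "last M = b i" "length M = i - j + 1" "set M \<subseteq> b ` {..l}"
      using *[of j i] assms(3) by auto
    then show ?thesis using False walk_rev[OF M(1)]
      by (intro exI[of _ "rev M"]) (auto simp: hd_rev last_rev)
  qed
qed

end

locale chord_graph = conn_graph +
  fixes N :: nat
  assumes short_chord: "\<And>w. closed_walk w \<Longrightarrow> N + 1 < length w \<Longrightarrow> has_short_chord w"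
begin

text \<open>The constant comes from solving \<open>D * (D - 1) \<le> (2 * N)\<^sup>2 * (40 * D) powr (3 / 2)\<close>, the detour inequality
  for walks of length \<open>20 * D\<close>: the left-hand side grows faster in \<open>D\<close>, so \<open>D\<close> is bounded.\<close>

definition morse_const :: nat where
  "morse_const = 64000 * (2 * N) ^ 4 + 2"

lemma le_morse_const:
  assumes "real (D * (D - 1)) \<le> (2 * N)\<^sup>2 * (2 * (20 * D) * sqrt (2 * (20 * D)))"
  shows "D \<le> morse_const"
proof (cases "D = 0")
  case False
  define x K where "x = real D" and "K = (2 * real N)\<^sup>2"
  have x: "1 \<le> x" using False by (simp add: x_def)
  have lhs: "x * (x - 1) = real (D * (D - 1))" using False by (simp add: x_def of_nat_diff)
  have "x * (x - 1) \<le> K * (40 * x * sqrt (40 * x))"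
    using assms unfolding lhs[symmetric] by (simp add: K_def x_def)
  then have "x * (x - 1) \<le> x * (40 * K * sqrt (40 * x))" by (simp add: algebra_simps)
  then have "x - 1 \<le> 40 * K * sqrt (40 * x)" using x by simp
  then have "(x - 1)\<^sup>2 \<le> (40 * K * sqrt (40 * x))\<^sup>2" using x by (intro power_mono) auto
  also have "\<dots> = 64000 * K\<^sup>2 * x" using x by (simp add: power_mult_distrib)
  finally have "x * x \<le> (64000 * K\<^sup>2 + 2) * x" 
    by (simp add: power2_eq_square algebra_simps)
  then have "x \<le> 64000 * K\<^sup>2 + 2" using x by simp
  also have "K\<^sup>2 = real ((2 * N) ^ 4)" by (simp add: K_def power_mult_distrib)
  also have "64000 * real ((2 * N) ^ 4) + 2 = real morse_const" unfolding morse_const_def by (simp only: of_nat_add of_nat_mult of_nat_numeral)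
  finally show ?thesis by (simp add: x_def)
qed simp

text \<open>Let \<open>D\<close> be the largest distance from a point of the geodesic to \<open>b\<close>, attained at \<open>g k\<close>. Take the
  points of the geodesic at distance \<open>2 * D\<close> on either side of \<open>g k\<close> (or its ends), join each to a
  nearest point of \<open>b\<close>, and connect these two points along \<open>b\<close>. This walk avoids the ball of radius
  \<open>D\<close> around \<open>g k\<close>; the quasigeodesic condition bounds its length by \<open>D + 3 * (6 * D) + D = 20 * D\<close>.
  Long detours then force \<open>D\<close> to be bounded.\<close>

lemma geodesic_near_quasigeodesic:
  assumes b: "\<And>i. i < l \<Longrightarrow> {b i, b (Suc i)} \<in> E" "\<And>i. i \<le> l \<Longrightarrow> b i \<in> V"
    and qi: "\<And>i j. i \<le> j \<Longrightarrow> j \<le> l \<Longrightarrow> j - i \<le> 3 * d (b i) (b j)"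
    and g: "geodesic g n" "g 0 = b 0" "g n = b l" and j: "j \<le> n"
  shows "\<exists>i\<le>l. d (g j) (b i) \<le> morse_const"
proof -
  have "\<forall>v. \<exists>i\<le>l. \<forall>i'\<le>l. d v (b i) \<le> d v (b i')" by (intro allI ex_argmin_upto)
  then obtain c where c: "\<And>v. c v \<le> l" "\<And>v i. i \<le> l \<Longrightarrow> d v (b (c v)) \<le> d v (b i)" by metis
  define f where "f v = d v (b (c v))" for v
  obtain k where k: "k \<le> n" "\<And>j. j \<le> n \<Longrightarrow> f (g j) \<le> f (g k)"
    using ex_argmax_upto[of n "\<lambda>j. f (g j)"] by blast
  define D where "D = f (g k)"
  \<comment> \<open>Truncated subtraction and the minimum replace the points by the ends of a short geodesic.\<close>
  define p q where "p = k - 2 * D" and "q = min n (k + 2 * D)"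
  have pq: "p \<le> k" "k \<le> q" "q \<le> n" "p \<le> n" "q - p \<le> 4 * D"
    using k(1) by (auto simp: p_def q_def)
  note gV = geodesic_V[OF g(1)]
  have far_b: "D \<le> d (g k) (b i)" if "i \<le> l" for i
    using c(2)[OF that, of "g k"] by (simp add: D_def f_def)
  have ends: "f (g 0) = 0" "f (g n) = 0"
    using c(2)[of 0 "g 0"] c(2)[of l "g n"] g by (auto simp: f_def)
  \<comment> \<open>A shortest walk from \<open>g s\<close> to \<open>b\<close> stays \<open>D\<close> away from \<open>g k\<close>: it starts at distance \<open>2 * D\<close> and has
    length at most \<open>D\<close>, unless it is the single point \<open>g s\<close>, lying on \<open>b\<close>.\<close>
  have conn: "\<exists>W. walk W \<and> hd W = g s \<and> last W = b (c (g s)) \<and> length W = f (g s) + 1 \<and>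
      (\<forall>v\<in>set W. D \<le> d (g k) v)"
    if s: "s \<le> n" "f (g s) = 0 \<or> d (g k) (g s) = 2 * D" for s
  proof -
    have bV: "b (c (g s)) \<in> V" using c(1) b(2) by blast
    obtain W where W: "walk W" "hd W = g s" "last W = b (c (g s))" "length W = Suc (f (g s))"
      using relpow_walk[OF relpow_d[OF gV[OF s(1)] bV] gV[OF s(1)]] unfolding f_def by blast
    have gs: "g s \<in> set W" using W(1,2) by (metis hd_in_set walk_def)
    then have near: "d v (g s) \<le> f (g s)" if "v \<in> set W" for v
      using walk_d_le[OF W(1) that gs] W(4) by simp
    have "D \<le> d (g k) v" if v: "v \<in> set W" for v
    proof (cases "f (g s) = 0")
      case True
      have "v = g s" using near[OF v] True d_eq_0[OF walk_V[OF W(1) v] gV[OF s(1)]] by simp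
      moreover have "g s = b (c (g s))" using True d_eq_0[OF gV[OF s(1)] bV] by (simp add: f_def)
      ultimately show ?thesis using far_b[OF c(1)] by metis
    next
      case False
      then have "2 * D \<le> d (g k) v + d v (g s)"
        using s d_triangle[OF gV[OF k(1)] walk_V[OF W(1) v] gV[OF s(1)]] by simp
      then show ?thesis using near[OF v] k(2)[OF s(1)] by (simp add: D_def)
    qed
    then show ?thesis using W by (intro exI[of _ W]) simp
  qed
  have "f (g p) = 0 \<or> d (g k) (g p) = 2 * D"
  proof (cases "2 * D \<le> k")
    case True
    then show ?thesis using geodesic_d[OF g(1), of p k] pq k(1) by (simp add: p_def d_sym)
  qed (simp add: p_def ends)
  from conn[OF pq(4) this] obtain W1 where W1: "walk W1" "hd W1 = g p" "last W1 = b (c (g p))"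
    "length W1 = f (g p) + 1" "\<forall>v\<in>set W1. D \<le> d (g k) v" by blast
  have "f (g q) = 0 \<or> d (g k) (g q) = 2 * D"
  proof (cases "k + 2 * D \<le> n")
    case True
    then show ?thesis using geodesic_d[OF g(1), of k q] pq k(1) by (simp add: q_def)
  qed (simp add: q_def ends)
  from conn[OF pq(3) this] obtain W3 where W3: "walk W3" "hd W3 = g q" "last W3 = b (c (g q))"
    "length W3 = f (g q) + 1" "\<forall>v\<in>set W3. D \<le> d (g k) v" by blast
  let ?i = "c (g p)" and ?j = "c (g q)"
  obtain W2 where W2: "walk W2" "hd W2 = b ?i" "last W2 = b ?j"
    "length W2 = (?i - ?j) + (?j - ?i) + 1" "set W2 \<subseteq> b ` {..l}"
    using walk_segment[of l b ?i ?j] b c(1) by blast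
  have fD: "f (g p) \<le> D" "f (g q) \<le> D" using k(2) pq by (auto simp: D_def)
  have bV: "b ?i \<in> V" "b ?j \<in> V" using b(2) c(1) by auto
  have "d (b ?i) (b ?j) \<le> f (g p) + (q - p) + f (g q)"
    using d_triangle[OF bV(1) gV[OF pq(4)] bV(2)] d_triangle[OF gV[OF pq(4)] gV[OF pq(3)] bV(2)]
      geodesic_d[OF g(1), of p q] pq d_sym[of "b ?i" "g p"] by (simp add: f_def)
  then have dij: "d (b ?i) (b ?j) \<le> 6 * D" using fD pq(5) by simp
  have "(?i - ?j) + (?j - ?i) \<le> 3 * d (b ?i) (b ?j)"
    using qi[of ?i ?j] qi[of ?j ?i] c(1) d_sym[of "b ?i"] by (cases "?i \<le> ?j") auto
  then have len2: "length W2 \<le> 18 * D + 1" using dij W2(4) by simp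
  note J12 = walk_concat[OF W1(1) W2(1) W1(3)[folded W2(2)]]
  define W3' where "W3' = rev W3"
  have W3': "walk W3'" "hd W3' = b ?j" "last W3' = g q" "length W3' = f (g q) + 1"
    "\<forall>v\<in>set W3'. D \<le> d (g k) v"
    using W3 walk_rev[OF W3(1)] by (auto simp: W3'_def hd_rev last_rev)
  have l12: "last (W1 @ tl W2) = hd W3'" using J12(3) W2(3) W3'(2) by simp
  note J = walk_concat[OF J12(1) W3'(1) l12]
  define B where "B = (W1 @ tl W2) @ tl W3'"
  have B: "walk B" "hd B = g (p + 0)" "last B = g (p + (q - p))"
    using J J12 W1(2) W3'(3) pq by (auto simp: B_def)
  have len: "length B \<le> 20 * D + 1"
    using J(4) J12(4) len2 W1(4) W3'(4) fD unfolding B_def by linarith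
  have far: "D \<le> d (g k) v" if "v \<in> set B" for v
  proof -
    have "v \<in> set W1 \<union> set W2 \<union> set W3'" using that J(5) J12(5) unfolding B_def by blast
    then show ?thesis using W1(5) W2(5) W3'(5) far_b by auto
  qed
  have gs: "geodesic (\<lambda>i. g (p + i)) (q - p)" using geodesic_sub[OF g(1)] pq by simp
  have "D \<le> d (g (p + (k - p))) v" if "v \<in> set B" for v using far[OF that] pq by simp
  from geodesic_detour_long[where k = "k - p", OF short_chord gs _ B len this] pq
  have "D \<le> morse_const" by (intro le_morse_const) simp
  then show ?thesis using k(2)[OF j] c(1)[of "g j"] unfolding D_def f_def
    by (meson le_trans)
qed

text \<open>Following \<open>g\<close> to the point \<open>g k\<close> nearest to \<open>z\<close> and then a geodesic to \<open>z\<close> is a quasigeodesic with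
  constant \<open>3\<close>. A geodesic from \<open>g 0\<close> to \<open>z\<close> stays close to it, starting near the first leg and ending
  near the second. Where it switches, it is close to points of both legs, which are close to each other
  and therefore to the corner \<open>g k\<close>. So the geodesic passes near \<open>g k\<close>, and the detour through \<open>g k\<close>
  costs a bounded amount.\<close>

lemma projection_almost_geodesic:
  assumes g: "geodesic g n" and k: "k \<le> n" and z: "z \<in> V"
    and nearest: "\<And>j. j \<le> n \<Longrightarrow> d z (g k) \<le> d z (g j)"
  shows "k + d (g k) z \<le> d (g 0) z + 2 * (7 * morse_const + 3)"
proof -
  note gV = geodesic_V[OF g]
  define e where "e = d (g k) z"
  obtain s where s: "geodesic s e" "s 0 = g k" "s e = z"
    using geodesic_exists[OF gV[OF k] z] unfolding e_def by blast
  define b where "b i = (if i \<le> k then g i else s (i - k))" for i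
  have b1: "b i = g i" if "i \<le> k" for i using that by (simp add: b_def)
  have b2: "b (k + i) = s i" for i using s by (simp add: b_def)
  have bV: "b i \<in> V" if "i \<le> k + e" for i
    using that gV[of i] k geodesic_V[OF s(1), of "i - k"] by (auto simp: b_def)
  have bE: "{b i, b (Suc i)} \<in> E" if "i < k + e" for i
  proof (cases "i < k")
    case True
    then show ?thesis using geodesic_edge[OF g, of i] k by (simp add: b_def)
  next
    case False
    then show ?thesis using geodesic_edge[OF s(1), of "i - k"] that b2[of "i - k"] b2[of "Suc i - k"]
      by (simp add: Suc_diff_le)
  qed
  \<comment> \<open>With \<open>A = k - i\<close> and \<open>j\<close> the distances to the corner, the distance of the two points is at least
    \<open>j\<close> because \<open>g k\<close> is nearest to \<open>z\<close>, and at least \<open>A - j\<close>; add twice the first bound.\<close>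
  have mixed: "(k - i) + j \<le> 3 * d (b i) (b (k + j))" if i: "i \<le> k" and j: "j \<le> e" for i j
  proof -
    have V: "g i \<in> V" "g k \<in> V" "s j \<in> V" using gV i k geodesic_V[OF s(1) j] by auto
    have "e \<le> d z (g i)" using nearest[of i] i k by (simp add: e_def d_sym)
    moreover have "d z (s j) = e - j" "d (g k) (s j) = j" "d (g i) (g k) = k - i"
      using geodesic_d[OF s(1) j] geodesic_d[OF s(1), of 0 j] geodesic_d[OF g i k] s j
      by (auto simp: d_sym)
    ultimately show ?thesis
      using d_triangle[OF z V(3,1)] d_triangle[OF V(1,3,2)] j d_sym[of "s j"]
      by (simp add: b1[OF i] b2)
  qed
  have qi: "j - i \<le> 3 * d (b i) (b j)" if ij: "i \<le> j" "j \<le> k + e" for i j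
  proof -
    consider "j \<le> k" | "i \<le> k" "k \<le> j" | "k \<le> i" using ij by linarith
    then show ?thesis
    proof cases
      case 1
      then show ?thesis using geodesic_d[OF g, of i j] ij k by (simp add: b1)
    next
      case 2
      then show ?thesis using mixed[of i "j - k"] ij by simp
    next
      case 3
      then show ?thesis using geodesic_d[OF s(1), of "i - k" "j - k"] ij b2[of "i - k"] b2[of "j - k"]
        by simp
    qed
  qed
  have V0: "g 0 \<in> V" using gV by simp
  define n' where "n' = d (g 0) z"
  obtain h where h: "geodesic h n'" "h 0 = g 0" "h n' = z"
    using geodesic_exists[OF V0 z] unfolding n'_def by blast
  have near: "\<exists>i\<le>k + e. d (h j) (b i) \<le> morse_const" if "j \<le> n'" for j
    using geodesic_near_quasigeodesic[of "k + e" b h n' j] bE bV qi h that b1[of 0] b2[of e] s(3)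
    by simp
  define P where "P j \<longleftrightarrow> (\<exists>i\<le>k. d (h j) (b i) \<le> morse_const)" for j
  have "P 0" unfolding P_def using h(2) b1[of 0] by (intro exI[of _ 0]) simp
  show ?thesis
  proof (cases "P n'")
    case True
    then obtain i where "i \<le> k" "d z (g i) \<le> morse_const" using h(3) b1 by (auto simp: P_def)
    then have "e \<le> morse_const" using nearest[of i] k by (simp add: e_def d_sym)
    moreover have "k \<le> n' + e"
      using d_triangle[OF V0 z gV[OF k]] geodesic_d[OF g, of 0 k] k by (simp add: n'_def e_def d_sym)
    ultimately show ?thesis by (simp add: e_def n'_def)
  next
    case False
    with \<open>P 0\<close> obtain j where j: "j < n'" "P j" "\<not> P (Suc j)" using ex_last_step by blast
    obtain i where i: "i \<le> k" "d (h j) (b i) \<le> morse_const" using j(2) by (auto simp: P_def)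
    obtain i' where i': "i' \<le> k + e" "d (h (Suc j)) (b i') \<le> morse_const" using near[of "Suc j"] j(1) by auto
    have "k < i'" using j(3) i'(2) by (auto simp: P_def not_le[symmetric])
    have hV: "h j \<in> V" "h (Suc j) \<in> V" using geodesic_V[OF h(1)] j(1) by auto
    have iV: "b i \<in> V" "b i' \<in> V" using bV i i' by auto
    have "d (h j) (h (Suc j)) = 1" using geodesic_d[OF h(1), of j "Suc j"] j(1) by simp
    then have "d (b i) (b i') \<le> 2 * morse_const + 1"
      using d_triangle[OF iV(1) hV(1) iV(2)] d_triangle[OF hV iV(2)] i(2) i'(2) d_sym[of "b i"]
      by simp
    then have "i' - i \<le> 6 * morse_const + 3" using qi[of i i'] i(1) i'(1) \<open>k < i'\<close> by simp
    then have "d (b i) (g k) \<le> 6 * morse_const + 3"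
      using geodesic_d[OF g i(1) k] \<open>k < i'\<close> i(1) by (simp add: b1)
    then have c: "d (h j) (g k) \<le> 7 * morse_const + 3"
      using d_triangle[OF hV(1) iV(1) gV[OF k]] i(2) by simp
    have "k \<le> j + d (h j) (g k)"
      using d_triangle[OF V0 hV(1) gV[OF k]] geodesic_d[OF g, of 0 k] k
        geodesic_d[OF h(1), of 0 j] h(2) j(1) by simp
    moreover have "e \<le> (n' - j) + d (h j) (g k)"
      using d_triangle[OF gV[OF k] hV(1) z] geodesic_d[OF h(1), of j n'] h(3) j(1)
        d_sym[of "g k"] by (simp add: e_def)
    ultimately show ?thesis using c j(1) by (simp add: e_def n'_def)
  qed
qed

lemma projection_almost_geodesic_rev:
  assumes g: "geodesic g n" and k: "k \<le> n" and z: "z \<in> V"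
    and nearest: "\<And>j. j \<le> n \<Longrightarrow> d z (g k) \<le> d z (g j)"
  shows "(n - k) + d (g k) z \<le> d (g n) z + 2 * (7 * morse_const + 3)"
  using projection_almost_geodesic[OF geodesic_rev[OF g], of "n - k" z] nearest[of "n - _"] k z
  by simp

text \<open>Up to bounded errors the Gromov product of \<open>x\<close> and \<open>z\<close> at \<open>w\<close> is the distance from \<open>w\<close> to its
  projection \<open>v\<close> on a geodesic from \<open>x\<close> to \<open>z\<close>. Projecting \<open>y\<close> to the same geodesic, \<open>v\<close> lies before
  or after the projection, hence almost on a geodesic from \<open>x\<close> to \<open>y\<close> or from \<open>y\<close> to \<open>z\<close>. Passing
  through \<open>v\<close> bounds the corresponding Gromov product at \<open>w\<close> by \<open>d v w\<close>.\<close>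

lemma four_point_vertices:
  assumes V: "w \<in> V" "x \<in> V" "y \<in> V" "z \<in> V"
  shows "min (gromov_product (\<lambda>u v. real (d u v)) w x y) (gromov_product (\<lambda>u v. real (d u v)) w y z)
    - 3 * (7 * real morse_const + 3) \<le> gromov_product (\<lambda>u v. real (d u v)) w x z"
proof -
  let ?n = "d x z"
  define e where "e = 7 * morse_const + 3"
  obtain g where g: "geodesic g ?n" "g 0 = x" "g ?n = z" using geodesic_exists[OF V(2,4)] by blast
  obtain k where k: "k \<le> ?n" "\<And>j. j \<le> ?n \<Longrightarrow> d w (g k) \<le> d w (g j)"
    using ex_argmin_upto[of ?n "\<lambda>j. d w (g j)"] by blast
  obtain k' where k': "k' \<le> ?n" "\<And>j. j \<le> ?n \<Longrightarrow> d y (g k') \<le> d y (g j)"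
    using ex_argmin_upto[of ?n "\<lambda>j. d y (g j)"] by blast
  define v v' where "v = g k" and "v' = g k'"
  have vV: "v \<in> V" "v' \<in> V" using geodesic_V[OF g(1)] k k' by (auto simp: v_def v'_def)
  note pw = projection_almost_geodesic[OF g(1) k(1) V(1) k(2), folded e_def]
    projection_almost_geodesic_rev[OF g(1) k(1) V(1) k(2), folded e_def]
  note py = projection_almost_geodesic[OF g(1) k'(1) V(3) k'(2), folded e_def]
    projection_almost_geodesic_rev[OF g(1) k'(1) V(3) k'(2), folded e_def]
  have lower: "?n + 2 * d v w \<le> d x w + d z w + 4 * e"
    using pw k(1) g by (simp add: v_def)
  have dist_v: "d x v = k" "d v z = ?n - k"
    using geodesic_d[OF g(1), of 0 k] geodesic_d[OF g(1), of k ?n] g k(1) by (auto simp: v_def)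
  have yw: "d y w \<le> d v y + d v w" using d_triangle[OF V(3) vV(1) V(1)] d_sym[of y v] by simp
  have "d x w + d y w \<le> d x y + 2 * d v w + 2 * e \<or> d y w + d z w \<le> d y z + 2 * d v w + 2 * e"
  proof (cases "k \<le> k'")
    case True
    have "d v v' = k' - k" using geodesic_d[OF g(1) True k'(1)] by (simp add: v_def v'_def)
    then have "k + d v y \<le> d x y + 2 * e"
      using py(1) True g(2) d_triangle[OF vV V(3)] by (simp add: v'_def)
    moreover have "d x w \<le> k + d v w" using d_triangle[OF V(2) vV(1) V(1)] dist_v by simp
    ultimately show ?thesis using yw by linarith
  next
    case False
    have "d v v' = k - k'" using geodesic_d[OF g(1), of k' k] False k(1)
      by (simp add: v_def v'_def d_sym)
    then have "(?n - k) + d v y \<le> d z y + 2 * e"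
      using py(2) False g(3) k(1) d_triangle[OF vV V(3)] by (simp add: v'_def)
    moreover have "d z w \<le> (?n - k) + d v w"
      using d_triangle[OF V(4) vV(1) V(1)] dist_v d_sym[of z v] by simp
    ultimately show ?thesis using yw d_sym[of z y] by linarith
  qed
  then have "real (d x w) + real (d y w) \<le> real (d x y) + 2 * real (d v w) + 2 * real e
      \<or> real (d y w) + real (d z w) \<le> real (d y z) + 2 * real (d v w) + 2 * real e"
    by linarith
  moreover have "real ?n + 2 * real (d v w) \<le> real (d x w) + real (d z w) + 4 * real e"
    using lower by linarith
  moreover have "7 * real morse_const + 3 = real e" by (simp add: e_def)
  ultimately show ?thesis unfolding gromov_product_def min_def by (auto simp: field_simps)
qed

end

section \<open>Cycles without short chords are bi-Lipschitz\<close>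

lemma cycle_forward:
  assumes "i < n" and E': "\<And>i. i < n \<Longrightarrow> {c i, c (Suc i mod n)} \<in> E'"
  shows "(c i, c ((i + k) mod n)) \<in> adj E' ^^ k"
proof (induction k)
  case 0
  then show ?case using assms(1) by simp
next
  case (Suc k)
  have "{c ((i + k) mod n), c (Suc ((i + k) mod n) mod n)} \<in> E'" using assms(1) by (intro E') simp
  then have "(c ((i + k) mod n), c ((i + Suc k) mod n)) \<in> adj E'"
    by (simp add: mod_Suc_eq)
  then show ?case using Suc.IH by auto
qed

text \<open>It suffices to compare distances between vertices of the cycle, with no loss in the constant. A path
  between arbitrary points of the cycle that leaves their edges does so through vertices of the cycle;
  the two end legs are common to the graph and the cycle, and only the middle part gets longer when
  rerouted along the cycle. Rounding to vertices would instead cost an additive error.\<close>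

lemma bilipschitz_cyclic_subgraphI:
  assumes simple: "simple_graph V E" and n: "3 \<le> n" and inj: "inj_on c {..<n}"
    and E: "\<And>i. i < n \<Longrightarrow> {c i, c (Suc i mod n)} \<in> E"
    and far: "\<And>i j k. i < j \<Longrightarrow> j < n \<Longrightarrow> (c i, c j) \<in> adj E ^^ k \<Longrightarrow> j - i \<le> 18 * k \<or> n - (j - i) \<le> 18 * k"
  shows "bilipschitz_cyclic_subgraph 18 V E n (c ` {..<n}) ((\<lambda>i. {c i, c (Suc i mod n)}) ` {..<n})"
proof -
  define V' E' where "V' = c ` {..<n}" and "E' = (\<lambda>i. {c i, c (Suc i mod n)}) ` {..<n}"
  have sub: "V' \<subseteq> V" "E' \<subseteq> E" using E simple by (force simp: V'_def E'_def simple_graph_def)+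
  have ends: "u \<in> V'" "v \<in> V'" "u \<noteq> v" if "{u, v} \<in> E'" for u v
  proof -
    have "\<exists>i<n. {u, v} = {c i, c (Suc i mod n)}" using that by (auto simp: E'_def)
    then show "u \<in> V'" "v \<in> V'" using n by (auto simp: V'_def doubleton_eq_iff)
    show "u \<noteq> v" using subsetD[OF sub(2) that] simple by (auto simp: simple_graph_def)
  qed
  have fwd: "(c i, c ((i + k) mod n)) \<in> adj E' ^^ k" if "i < n" for i k
    using that by (rule cycle_forward) (auto simp: E'_def)
  have short: "\<exists>k'\<le>18 * k. (a, b) \<in> adj E' ^^ k'"
    if ab: "a \<in> V'" "b \<in> V'" "(a, b) \<in> adj E ^^ k" for a b k
  proof -
    have lt: "\<exists>k'\<le>18 * k. (c i, c j) \<in> adj E' ^^ k'"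
      if "i < j" "j < n" "(c i, c j) \<in> adj E ^^ k" for i j
    proof -
      have 1: "(c i, c j) \<in> adj E' ^^ (j - i)" using fwd[of i "j - i"] that by simp
      have "j + (n - (j - i)) = n + i" using that by simp
      then have "(c j, c i) \<in> adj E' ^^ (n - (j - i))" using fwd[of j "n - (j - i)"] that by simp
      then have "(c i, c j) \<in> adj E' ^^ (n - (j - i))" by (rule relpow_adj_sym)
      with 1 far[OF that] show ?thesis by blast
    qed
    obtain i j where ij: "a = c i" "i < n" "b = c j" "j < n" using ab by (auto simp: V'_def)
    consider "i < j" | "j < i" | "i = j" by linarith
    then show ?thesis
    proof cases
      case 1
      then show ?thesis using lt ij ab by blast
    next
      case 2
      have "(c j, c i) \<in> adj E ^^ k" using relpow_adj_sym[OF ab(3)] ij by simp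
      then obtain k' where "k' \<le> 18 * k" and k': "(c j, c i) \<in> adj E' ^^ k'" using lt[OF 2] ij by blast
      then show ?thesis using relpow_adj_sym[OF k'] ij by blast
    next
      case 3
      then show ?thesis using ij by (intro exI[of _ 0]) simp
    qed
  qed
  have real': "\<exists>u v s. x = edge_point u v s \<and> {u, v} \<in> E' \<and> 0 \<le> s \<and> s \<le> 1"
    if "x \<in> realization V' E'" for x
  proof -
    have "(\<exists>u v s. x = edge_point u v s \<and> {u, v} \<in> E' \<and> 0 \<le> s \<and> s \<le> 1) \<or> (\<exists>v\<in>V'. x = vertex_point v)"
      using that unfolding realization_def by auto
    then consider u v s where "x = edge_point u v s" "{u, v} \<in> E'" "0 \<le> s" "s \<le> 1"
      | i where "x = vertex_point (c i)" "i < n"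
      unfolding V'_def by blast
    then show ?thesis
    proof cases
      case 1
      then show ?thesis by blast
    next
      case 2
      then have "x = edge_point (c i) (c (Suc i mod n)) 0" "{c i, c (Suc i mod n)} \<in> E'"
        by (auto simp: E'_def)
      then show ?thesis by (metis order_refl zero_le_one)
    qed
  qed
  have "1 / 18 * graph_dist E' x y \<le> graph_dist E x y \<and> graph_dist E x y \<le> graph_dist E' x y"
    if xy: "x \<in> realization V' E'" "y \<in> realization V' E'" for x y
  proof -
    obtain u v s where x: "x = edge_point u v s" "{u, v} \<in> E'" "0 \<le> s" "s \<le> 1"
      using real'[OF xy(1)] by blast
    obtain u' v' s' where y: "y = edge_point u' v' s'" "{u', v'} \<in> E'" "0 \<le> s'" "s' \<le> 1"
      using real'[OF xy(2)] by blast
    have to_x: "pl_path E' x (vertex_point a) (1 - x a)" if "a \<in> {u, v}" for a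
      unfolding x(1) using pl_path_to_endpoint[OF x(2) ends(3)[OF x(2)] x(3,4) that] .
    have to_y: "pl_path E' (vertex_point b) y (1 - y b)" if "b \<in> {u', v'}" for b
      unfolding y(1) using pl_path_sym[OF pl_path_to_endpoint[OF y(2) ends(3)[OF y(2)] y(3,4) that]] .
    have inV': "a \<in> {u, v} \<Longrightarrow> a \<in> V'" "a \<in> {u', v'} \<Longrightarrow> a \<in> V'" for a
      using ends[OF x(2)] ends[OF y(2)] by auto
    have shorter: "\<exists>l'\<le>18 * l. pl_path E' x y l'" if l: "pl_path E x y l" for l
    proof -
      have l0: "0 \<le> l" using pl_path_nonneg[OF l] .
      from pl_path_cases[OF simple l] consider "x = y" | "vertex_route E x y l"
        | p q t t' where "{p, q} \<in> E" "0 < t" "t < 1" "0 \<le> t'" "t' \<le> 1"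
          "x = edge_point p q t" "y = edge_point p q t'" "\<bar>t - t'\<bar> \<le> l" by blast
      then show ?thesis
      proof cases
        case 1
        then show ?thesis using l0 pl_path.refl by (intro exI[of _ 0]) auto
      next
        case 2
        then obtain a b k where ab: "0 < x a" "0 < y b" "(a, b) \<in> adj E ^^ k"
          "(1 - x a) + real k + (1 - y b) \<le> l" unfolding vertex_route_def by blast
        have a: "a \<in> {u, v}" using ab(1) unfolding x(1) by (rule edge_point_pos)
        have b: "b \<in> {u', v'}" using ab(2) unfolding y(1) by (rule edge_point_pos)
        obtain k' where k': "k' \<le> 18 * k" "(a, b) \<in> adj E' ^^ k'"
          using short[OF inV'(1)[OF a] inV'(2)[OF b] ab(3)] by blast
        have "pl_path E' x y ((1 - x a) + (real k' + (1 - y b)))"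
          by (intro pl_path_trans[OF to_x[OF a]] pl_path_trans[OF pl_path_relpow[OF k'(2)]] to_y b)
        moreover have "(1 - x a) + (real k' + (1 - y b)) \<le> 18 * l"
          using ab(4) k'(1) pl_path_nonneg[OF to_x[OF a]] pl_path_nonneg[OF to_y[OF b]] by linarith
        ultimately show ?thesis by blast
      next
        case 3
        have pq: "p \<noteq> q" using 3(1) simple by (auto simp: simple_graph_def)
        then have "0 < x p" "0 < x q" using 3(2,3,6) by (auto simp: edge_point_left edge_point_right)
        then have "p \<in> {u, v}" "q \<in> {u, v}" unfolding x(1) by (blast dest: edge_point_pos)+
        then have "{p, q} \<in> E'" using pq x(2) by (auto simp: insert_commute)
        then have "pl_path E' x y \<bar>t - t'\<bar>" using pl_path_edge[of p q E' t t'] 3 by simp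
        moreover have "\<bar>t - t'\<bar> \<le> 18 * l" using 3(8) l0 by linarith
        ultimately show ?thesis by blast
      qed
    qed
    obtain i j where ij: "u = c i" "i < n" "u' = c j" "j < n"
      using inV'(1)[of u] inV'(2)[of u'] by (auto simp: V'_def)
    have "(i + (j + n - i)) mod n = j" using ij by simp
    then have "(u, u') \<in> adj E' ^^ (j + n - i)" using fwd[OF ij(2), of "j + n - i"] ij by simp
    from pl_path_trans[OF to_x[of u] pl_path_trans[OF pl_path_relpow[OF this] to_y]]
    obtain l where l: "pl_path E' x y l" by blast
    have "1 / 18 * graph_dist E' x y \<le> m" if m: "pl_path E x y m" for m
    proof -
      obtain l' where "l' \<le> 18 * m" "pl_path E' x y l'" using shorter[OF m] by blast
      then show ?thesis using graph_dist_le[of E' x y l'] by simp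
    qed
    then have "1 / 18 * graph_dist E' x y \<le> graph_dist E x y"
      by (intro graph_dist_ge[OF pl_path_mono[OF l sub(2)]])
    moreover have "graph_dist E x y \<le> graph_dist E' x y"
      by (intro graph_dist_ge[OF l] graph_dist_le pl_path_mono[OF _ sub(2)])
    ultimately show ?thesis by blast
  qed
  moreover have "cyclic_graph n V' E'"
    unfolding cyclic_graph_def V'_def E'_def using n inj by blast
  ultimately have "bilipschitz_cyclic_subgraph 18 V E n V' E'"
    using sub unfolding bilipschitz_cyclic_subgraph_def by blast
  then show ?thesis by (simp add: V'_def E'_def)
qed

context conn_graph
begin

lemma has_short_chordI:
  assumes ij: "i < j" "j < length w" and s: "walk s" "hd s = w ! i" "last s = w ! j"
    "18 * (length s - 1) < j - i" "18 * (length s - 1) < length w - 1 - (j - i)"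
  shows "has_short_chord w"
proof -
  let ?w' = "drop (Suc i) w"
  have "w = take i w @ w ! i # ?w'" using ij by (intro id_take_nth_drop) simp
  also have "?w' = take (j - Suc i) ?w' @ ?w' ! (j - Suc i) # drop (Suc (j - Suc i)) ?w'"
    using ij by (intro id_take_nth_drop) simp
  also have "?w' ! (j - Suc i) = w ! j" using ij by simp
  also have "drop (Suc (j - Suc i)) ?w' = drop (Suc j) w" using ij by simp
  finally have "w = take i w @ w ! i # take (j - Suc i) ?w' @ w ! j # drop (Suc j) w" .
  moreover have "18 * (length s - 1) < length (take (j - Suc i) ?w') + 1"
    "18 * (length s - 1) < length (take i w) + length (drop (Suc j) w)"
    using s(4,5) ij by auto
  ultimately show ?thesis unfolding has_short_chord_def using s(1-3) by blast
qed

text \<open>A closed walk repeating a vertex has a chord of length \<open>0\<close>. Otherwise it traverses a cyclic subgraph,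
  which would be bi-Lipschitz embedded and too long if no pair of vertices gave a short chord.\<close>

lemma long_closed_walk_has_short_chord:
  assumes bound: "\<And>n V' E'. bilipschitz_cyclic_subgraph 18 V E n V' E' \<Longrightarrow> n \<le> N"
    and N: "3 \<le> N" and w: "closed_walk w" "N + 1 < length w"
  shows "has_short_chord w"
proof (rule ccontr)
  assume none: "\<not> has_short_chord w"
  define L where "L = length w - 1"
  have L: "length w = L + 1" "N < L" using w(2) by (auto simp: L_def)
  have "walk w" "hd w = last w" using w(1) by (simp_all only: closed_walk_def)
  moreover have "w \<noteq> []" using L by auto
  ultimately have walk: "walk w" "w ! 0 = w ! L"
    using hd_conv_nth[of w] last_conv_nth[of w] by (simp_all add: L_def)
  have wV: "w ! i \<in> V" if "i \<le> L" for i using walk_V[OF walk(1)] that L(1) by simp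
  have no_chord: "j - i \<le> 18 * k \<or> L - (j - i) \<le> 18 * k"
    if ij: "i < j" "j < L" and k: "(w ! i, w ! j) \<in> adj E ^^ k" for i j k
  proof -
    obtain s where "walk s" "hd s = w ! i" "last s = w ! j" "length s = Suc k"
      using relpow_walk[OF k] wV[of i] ij by auto
    then show ?thesis using has_short_chordI[of i j w s] ij none L by fastforce
  qed
  have "inj_on (\<lambda>i. w ! i) {..<L}"
  proof -
    have "w ! i \<noteq> w ! j" if "i < j" "j < L" for i j
      using no_chord[OF that, of 0] that by auto
    then show ?thesis by (auto simp: inj_on_def) (metis linorder_neqE_nat)
  qed
  moreover have "{w ! i, w ! (Suc i mod L)} \<in> E" if "i < L" for i
  proof -
    have "{w ! i, w ! Suc i} \<in> E" using walk_relpow[OF walk(1), of i "Suc i"] that L by simp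
    then show ?thesis using that walk(2) by (cases "Suc i = L") auto
  qed
  ultimately have "bilipschitz_cyclic_subgraph 18 V E L ((\<lambda>i. w ! i) ` {..<L})
      ((\<lambda>i. {w ! i, w ! (Suc i mod L)}) ` {..<L})"
    using N L(2) no_chord by (intro bilipschitz_cyclic_subgraphI[OF simple]) auto
  then show False using bound L(2) by (meson not_le)
qed

end

section \<open>Bi-Lipschitz cycles in hyperbolic graphs\<close>

text \<open>Each Gromov product changes by at most \<open>3 / 2 * c\<close>, so the four-point inequality survives with a
  larger constant. This moves hyperbolicity between the realization and the vertex set.\<close>

lemma gromov_hyperbolic_transfer:
  assumes hyp: "gromov_hyperbolic M d" and f: "\<And>p. p \<in> M' \<Longrightarrow> f p \<in> M"
    and close: "\<And>p q. p \<in> M' \<Longrightarrow> q \<in> M' \<Longrightarrow> \<bar>d' p q - d (f p) (f q)\<bar> \<le> c" and c: "0 \<le> c"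
  shows "gromov_hyperbolic M' d'"
proof -
  obtain \<delta> where \<delta>: "0 \<le> \<delta>" "\<And>w x y z. w \<in> M \<Longrightarrow> x \<in> M \<Longrightarrow> y \<in> M \<Longrightarrow> z \<in> M \<Longrightarrow>
      gromov_product d w x z \<ge> min (gromov_product d w x y) (gromov_product d w y z) - \<delta>"
    using hyp unfolding gromov_hyperbolic_def by blast
  have gp: "\<bar>gromov_product d' w x y - gromov_product d (f w) (f x) (f y)\<bar> \<le> 3 / 2 * c"
    if "w \<in> M'" "x \<in> M'" "y \<in> M'" for w x y
    using close[of x w] close[of y w] close[of x y] that
    unfolding gromov_product_def abs_le_iff by (simp add: field_simps)
  have "gromov_product d' w x z \<ge>
      min (gromov_product d' w x y) (gromov_product d' w y z) - (\<delta> + 3 * c)"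
    if V: "w \<in> M'" "x \<in> M'" "y \<in> M'" "z \<in> M'" for w x y z
    using \<delta>(2)[OF V[THEN f]] gp[OF V(1,2,4)] gp[OF V(1,2,3)] gp[OF V(1,3,4)]
    unfolding abs_le_iff min_def by (auto split: if_splits)
  moreover have "0 \<le> \<delta> + 3 * c" using \<delta>(1) c by simp
  ultimately show ?thesis unfolding gromov_hyperbolic_def by blast
qed

text \<open>Bisecting a chain of \<open>2 ^ k\<close> steps and following the half with the smaller product loses \<open>\<delta>\<close> only
  \<open>k\<close> times. Geometrically: a path of length \<open>h\<close> passes within about \<open>\<delta> * log 2 h\<close> of every point of
  a geodesic with the same ends.\<close>

lemma gromov_product_chain:
  assumes hyp: "\<And>w x y z. w \<in> M \<Longrightarrow> x \<in> M \<Longrightarrow> y \<in> M \<Longrightarrow> z \<in> M \<Longrightarrow>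
      gromov_product d w x z \<ge> min (gromov_product d w x y) (gromov_product d w y z) - \<delta>"
    and \<delta>: "0 \<le> \<delta>" and x: "\<And>i. x i \<in> M" and w: "w \<in> M" and h: "1 \<le> h" "h \<le> 2 ^ k"
  shows "\<exists>j. i \<le> j \<and> j < i + h \<and>
    gromov_product d w (x j) (x (Suc j)) \<le> gromov_product d w (x i) (x (i + h)) + real k * \<delta>"
  using h
proof (induction k arbitrary: i h)
  case 0
  then show ?case by (intro exI[of _ i]) auto
next
  case (Suc k)
  show ?case
  proof (cases "h \<le> 2 ^ k")
    case True
    obtain j where j: "i \<le> j" "j < i + h"
      "gromov_product d w (x j) (x (Suc j)) \<le> gromov_product d w (x i) (x (i + h)) + real k * \<delta>"
      using Suc.IH[OF Suc.prems(1) True] by blast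
    moreover have "real k * \<delta> \<le> real (Suc k) * \<delta>" using \<delta> by (intro mult_right_mono) auto
    ultimately show ?thesis by (intro exI[of _ j]) linarith
  next
    case False
    define m where "m = i + 2 ^ k"
    have ih: "m + (h - 2 ^ k) = i + h" using False by (simp add: m_def)
    from Suc.IH[of "2 ^ k" i] obtain j1 where j1: "i \<le> j1" "j1 < m"
      "gromov_product d w (x j1) (x (Suc j1)) \<le> gromov_product d w (x i) (x m) + real k * \<delta>"
      by (auto simp: m_def)
    have "1 \<le> h - 2 ^ k" "h - 2 ^ k \<le> 2 ^ k" using False Suc.prems by auto
    from Suc.IH[OF this, of m] obtain j2 where j2: "m \<le> j2" "j2 < i + h"
      "gromov_product d w (x j2) (x (Suc j2)) \<le> gromov_product d w (x m) (x (i + h)) + real k * \<delta>"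
      unfolding ih by blast
    have split: "min (gromov_product d w (x i) (x m)) (gromov_product d w (x m) (x (i + h)))
        \<le> gromov_product d w (x i) (x (i + h)) + \<delta>"
      using hyp[OF w x x x, of i m "i + h"] by simp
    have k: "real (Suc k) * \<delta> = real k * \<delta> + \<delta>" by (simp add: algebra_simps)
    show ?thesis
    proof (cases "gromov_product d w (x i) (x m) \<le> gromov_product d w (x m) (x (i + h))")
      case True
      then show ?thesis using j1 split k ih by (intro exI[of _ j1]) auto
    next
      case False
      then show ?thesis using j2 split k by (intro exI[of _ j2]) (auto simp: m_def)
    qed
  qed
qed

text \<open>The lift of a walk on the cycle to the integers moves by at most \<open>k\<close> in \<open>k\<close> steps, and its end is
  congruent to \<open>j - i\<close> modulo \<open>n\<close>.\<close>

lemma cycle_walk_length: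
  assumes inj: "inj_on c {..<n}" and n: "0 < n" and ij: "i < j" "j < n"
    and path: "(c i, c j) \<in> adj ((\<lambda>i. {c i, c (Suc i mod n)}) ` {..<n}) ^^ k"
  shows "j - i \<le> k \<or> n - (j - i) \<le> k"
proof -
  have "\<exists>t. \<bar>t\<bar> \<le> int k \<and> v = c (nat ((int i + t) mod int n))"
    if "(c i, v) \<in> adj ((\<lambda>i. {c i, c (Suc i mod n)}) ` {..<n}) ^^ k" for v k
    using that
  proof (induction k arbitrary: v)
    case 0
    then show ?case using ij by (intro exI[of _ 0]) auto
  next
    case (Suc k)
    then obtain u where u: "(c i, u) \<in> adj ((\<lambda>i. {c i, c (Suc i mod n)}) ` {..<n}) ^^ k"
      and "{u, v} \<in> (\<lambda>i. {c i, c (Suc i mod n)}) ` {..<n}" by auto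
    then obtain m where m: "m < n" "{u, v} = {c m, c (Suc m mod n)}" by auto
    obtain t where t: "\<bar>t\<bar> \<le> int k" "u = c (nat ((int i + t) mod int n))"
      using Suc.IH[OF u] by blast
    define a where "a = nat ((int i + t) mod int n)"
    have a: "int a = (int i + t) mod int n" "a < n"
      using n by (auto simp: a_def nat_less_iff)
    from m(2) consider "c a = c m" "v = c (Suc m mod n)" | "c a = c (Suc m mod n)" "v = c m"
      using t(2) by (auto simp: doubleton_eq_iff a_def)
    then show ?case
    proof cases
      case 1
      then have "a = m" using inj a(2) m(1) by (auto simp: inj_on_def)
      then have "int (Suc m mod n) = (int i + (t + 1)) mod int n"
        using a(1) by (simp add: zmod_int mod_simps algebra_simps)
      then have "v = c (nat ((int i + (t + 1)) mod int n))" using 1(2) by (metis nat_int)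
      then show ?thesis using t(1) by (intro exI[of _ "t + 1"]) auto
    next
      case 2
      then have "a = Suc m mod n" using inj a(2) m(1) n by (auto simp: inj_on_def)
      then have "(int m + 1) mod int n = (int i + t) mod int n"
        using a(1) by (simp add: zmod_int add.commute)
      then have "(int m + 1 - 1) mod int n = (int i + t - 1) mod int n" by (rule mod_diff_cong) simp
      then have "int m = (int i + (t - 1)) mod int n" using m(1) by (simp add: algebra_simps)
      then have "v = c (nat ((int i + (t - 1)) mod int n))" using 2(2) by (metis nat_int)
      then show ?thesis using t(1) by (intro exI[of _ "t - 1"]) auto
    qed
  qed
  from this[OF path] obtain t where t: "\<bar>t\<bar> \<le> int k" "c j = c (nat ((int i + t) mod int n))"
    by blast
  have "nat ((int i + t) mod int n) < n" using n by (simp add: nat_less_iff)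
  then have "j = nat ((int i + t) mod int n)" using inj t(2) ij by (auto simp: inj_on_def)
  then have "int j = (int i + t) mod int n" using n by simp
  then have "int i + t = int j + int n * ((int i + t) div int n)" by simp
  then have "t = int (j - i) + int n * ((int i + t) div int n)" using ij by linarith
  then obtain q where q: "t = int (j - i) + int n * q" by blast
  show ?thesis
  proof (cases "0 \<le> q")
    case True
    then have "0 \<le> int n * q" by simp
    then show ?thesis using q t(1) by linarith
  next
    case False
    then have "int n * q \<le> int n * (-1)" by (intro mult_left_mono) auto
    then show ?thesis using q t(1) ij by linarith
  qed
qed

text \<open>A consequence of \<open>m * m \<le> 2 * 2 ^ m\<close>.\<close>

lemma exponent_le_of_power_le_linear:
  fixes A B :: real
  assumes "0 \<le> A" "0 \<le> B" "2 ^ m \<le> A * real m + B"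
  shows "real m \<le> 2 * A + 2 * B"
proof (cases "m = 0")
  case False
  have "m * m \<le> 2 * 2 ^ m"
  proof (induction m)
    case (Suc m)
    have "Suc m * Suc m = m * m + 2 * m + 1" "(2::nat) * 2 ^ Suc m = 2 * 2 ^ m + 2 * 2 ^ m" by simp_all
    then show ?case using Suc less_exp[of m] by linarith
  qed simp
  then have "real (m * m) \<le> real (2 * 2 ^ m)" by (rule of_nat_mono)
  then have "real m * real m \<le> 2 * 2 ^ m" by simp
  also have "\<dots> \<le> 2 * A * real m + 2 * B" using assms(3) by simp
  also have "\<dots> \<le> 2 * A * real m + 2 * B * real m"
    using False assms(2) by (simp add: mult_le_cancel_left1)
  finally have "real m * real m \<le> (2 * A + 2 * B) * real m" by (simp add: algebra_simps)
  then show ?thesis using False by simp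
qed (use assms in simp)

context conn_graph
begin

lemma graph_dist_vertices: "a \<in> V \<Longrightarrow> b \<in> V \<Longrightarrow> graph_dist E (vertex_point a) (vertex_point b) = real (d a b)"
proof (rule antisym)
  assume V: "a \<in> V" "b \<in> V"
  note p = pl_path_relpow[OF relpow_d[OF V]]
  show "graph_dist E (vertex_point a) (vertex_point b) \<le> real (d a b)" using graph_dist_le[OF p] .
  show "real (d a b) \<le> graph_dist E (vertex_point a) (vertex_point b)"
  proof (rule graph_dist_ge[OF p])
    fix l assume "pl_path E (vertex_point a) (vertex_point b) l"
    then obtain k where "(a, b) \<in> adj E ^^ k" "real k \<le> l" using pl_path_vertices[OF simple] by blast
    then show "real (d a b) \<le> l" using d_le by fastforce
  qed
qed

lemma hyperbolic_iff_vertices: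
  "gromov_hyperbolic (realization V E) (graph_dist E) \<longleftrightarrow> gromov_hyperbolic V (\<lambda>u v. real (d u v))"
proof
  assume "gromov_hyperbolic (realization V E) (graph_dist E)"
  then show "gromov_hyperbolic V (\<lambda>u v. real (d u v))"
  proof (rule gromov_hyperbolic_transfer[where f = vertex_point and c = 0])
    show "vertex_point v \<in> realization V E" if "v \<in> V" for v
      using that edge_point_0[of v v] unfolding realization_def by force
  qed (simp_all add: graph_dist_vertices)
next
  assume hyp: "gromov_hyperbolic V (\<lambda>u v. real (d u v))"
  have "\<exists>a\<in>V. \<exists>l\<le>1. pl_path E p (vertex_point a) l" if "p \<in> realization V E" for p
  proof -
    from that consider v where "v \<in> V" "p = vertex_point v"
      | u v t where "{u, v} \<in> E" "0 \<le> t" "t \<le> 1" "p = edge_point u v t"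
      unfolding realization_def by auto
    then show ?thesis
    proof cases
      case 1
      then show ?thesis using pl_path.refl zero_le_one by blast
    next
      case 2
      then have "pl_path E p (vertex_point u) t" using pl_path_edge[of u v E t 0] by simp
      then show ?thesis using 2 edge_in_V by blast
    qed
  qed
  then obtain f where f: "\<And>p. p \<in> realization V E \<Longrightarrow> f p \<in> V"
    "\<And>p. p \<in> realization V E \<Longrightarrow> \<exists>l\<le>1. pl_path E p (vertex_point (f p)) l" by metis
  show "gromov_hyperbolic (realization V E) (graph_dist E)"
    using hyp f(1)
  proof (rule gromov_hyperbolic_transfer[where f = f and c = 2])
    fix p q assume pq: "p \<in> realization V E" "q \<in> realization V E"
    let ?p = "vertex_point (f p)" and ?q = "vertex_point (f q)"
    obtain l where l: "l \<le> 1" "pl_path E p ?p l" using f(2)[OF pq(1)] by blast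
    obtain m where m: "m \<le> 1" "pl_path E q ?q m" using f(2)[OF pq(2)] by blast
    note pq' = pl_path_relpow[OF relpow_d[OF f(1)[OF pq(1)] f(1)[OF pq(2)]]]
    note pp = pl_path_trans[OF l(2) pl_path_trans[OF pq' pl_path_sym[OF m(2)]]]
    have le: "graph_dist E p ?p \<le> 1" "graph_dist E q ?q \<le> 1"
      using graph_dist_le[OF l(2)] graph_dist_le[OF m(2)] l(1) m(1) by linarith+
    have "graph_dist E p q \<le> graph_dist E p ?p + (graph_dist E ?p ?q + graph_dist E ?q q)"
      using graph_dist_triangle[OF l(2) pl_path_trans[OF pq' pl_path_sym[OF m(2)]]]
        graph_dist_triangle[OF pq' pl_path_sym[OF m(2)]] by linarith
    moreover have "graph_dist E ?p ?q \<le> graph_dist E ?p p + (graph_dist E p q + graph_dist E q ?q)"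
      using graph_dist_triangle[OF pl_path_sym[OF l(2)] pl_path_trans[OF pp m(2)]]
        graph_dist_triangle[OF pp m(2)] by linarith
    ultimately show "\<bar>graph_dist E p q - real (d (f p) (f q))\<bar> \<le> 2"
      using le graph_dist_sym[of E ?q q] graph_dist_sym[of E ?p p]
        graph_dist_vertices[OF f(1)[OF pq(1)] f(1)[OF pq(2)]] by linarith
  qed auto
qed

text \<open>Let \<open>w\<close> be the midpoint of a geodesic between two opposite vertices of the cycle. Both arcs pass
  within \<open>R = k * \<delta> + 1\<close> of \<open>w\<close>, logarithmic in \<open>n\<close>. The two points found lie within \<open>2 * R\<close> of
  each other, but \<open>w\<close> is far from the two opposite vertices, so along the cycle they are separated by a
  distance linear in \<open>n\<close> on either side. The bi-Lipschitz condition makes \<open>n\<close> at most linear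
  in \<open>R\<close>.\<close>

lemma hyperbolic_bilipschitz_cycle_bound:
  assumes hyp: "\<And>w x y z. w \<in> V \<Longrightarrow> x \<in> V \<Longrightarrow> y \<in> V \<Longrightarrow> z \<in> V \<Longrightarrow>
      gromov_product (\<lambda>u v. real (d u v)) w x z
      \<ge> min (gromov_product (\<lambda>u v. real (d u v)) w x y) (gromov_product (\<lambda>u v. real (d u v)) w y z) - \<delta>"
    and \<delta>: "0 \<le> \<delta>" and cycle: "bilipschitz_cyclic_subgraph 18 V E n V' E'" and nk: "n \<le> 2 ^ k"
  shows "real n \<le> 2664 * (real k * \<delta> + 1) + 37"
proof -
  let ?gp = "gromov_product (\<lambda>u v. real (d u v))"
  obtain c where n: "3 \<le> n" and inj: "inj_on c {..<n}" and V': "V' = c ` {..<n}"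
    and E': "E' = (\<lambda>i. {c i, c (Suc i mod n)}) ` {..<n}" and sub: "V' \<subseteq> V" "E' \<subseteq> E"
    using cycle unfolding bilipschitz_cyclic_subgraph_def cyclic_graph_def by blast
  have simple': "simple_graph V' E'"
    unfolding simple_graph_def
  proof (intro ballI conjI)
    fix e assume e: "e \<in> E'"
    then obtain i where "i < n" "e = {c i, c (Suc i mod n)}" unfolding E' by blast
    then show "e \<subseteq> V'" using n by (simp add: V')
    show "card e = 2" using e simple sub(2) by (auto simp: simple_graph_def)
  qed
  have cV: "c i \<in> V" if "i < n" for i using that sub V' by auto
  have bil: "j - i \<le> 18 * d (c i) (c j) \<or> n - (j - i) \<le> 18 * d (c i) (c j)"
    if ij: "i < j" "j < n" for i j
  proof -
    let ?x = "vertex_point (c i)" and ?y = "vertex_point (c j)"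
    have xy: "?x \<in> realization V' E'" "?y \<in> realization V' E'"
      using ij edge_point_0[of "c i" "c i"] edge_point_0[of "c j" "c j"]
      unfolding realization_def V' by force+
    have "(c i, c ((i + (j - i)) mod n)) \<in> adj E' ^^ (j - i)"
      using ij by (intro cycle_forward) (auto simp: E')
    then have p: "pl_path E' ?x ?y (real (j - i))" using ij by (intro pl_path_relpow) simp
    have "real (min (j - i) (n - (j - i))) \<le> graph_dist E' ?x ?y"
    proof (rule graph_dist_ge[OF p])
      fix l assume "pl_path E' ?x ?y l"
      then obtain k where k: "(c i, c j) \<in> adj E' ^^ k" "real k \<le> l"
        using pl_path_vertices[OF simple'] by blast
      then show "real (min (j - i) (n - (j - i))) \<le> l"
        using cycle_walk_length[OF inj _ ij, of k] n unfolding E' by fastforce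
    qed
    also have "\<dots> \<le> 18 * graph_dist E ?x ?y"
      using cycle xy unfolding bilipschitz_cyclic_subgraph_def by fastforce
    also have "graph_dist E ?x ?y = real (d (c i) (c j))" using ij cV by (intro graph_dist_vertices) auto
    finally have "min (j - i) (n - (j - i)) \<le> 18 * d (c i) (c j)" by linarith
    then show ?thesis by (simp add: min_def split: if_splits)
  qed
  define x where "x i = c (i mod n)" for i
  have xV: "x i \<in> V" for i using cV n by (simp add: x_def)
  have x_step: "d (x i) (x (Suc i)) \<le> 1" for i
  proof (rule d_edge)
    have "{c (i mod n), c (Suc (i mod n) mod n)} \<in> E'" using n by (auto simp: E')
    then show "{x i, x (Suc i)} \<in> E" using sub by (auto simp: x_def mod_Suc_eq)
  qed
  have x_le: "d (x i) (x (i + t)) \<le> t" for i t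
  proof (induction t)
    case (Suc t)
    then show ?case using d_triangle[OF xV xV xV, of i "i + Suc t" "i + t"] x_step[of "i + t"] by simp
  qed simp
  define h where "h = n div 2"
  have h: "1 \<le> h" "h < n" "h \<le> n - h" "n \<le> 2 * h + 1" using n by (auto simp: h_def)
  define D where "D = d (x 0) (x h)"
  have x_id: "x i = c i" if "i < n" for i using that by (simp add: x_def)
  have hD: "h \<le> 18 * D" using bil[of 0 h] h by (auto simp: D_def x_def)
  obtain g where g: "geodesic g D" "g 0 = x 0" "g D = x h"
    using geodesic_exists[OF xV xV] unfolding D_def by blast
  define w where "w = g (D div 2)"
  have wV: "w \<in> V" using geodesic_V[OF g(1)] by (simp add: w_def)
  have dw: "d (x 0) w = D div 2" "d (x h) w = D - D div 2"
    using geodesic_d[OF g(1), of 0 "D div 2"] geodesic_d[OF g(1), of "D div 2" D] g d_sym[of "x h"]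
    by (auto simp: w_def)
  have "x n = x 0" "d (x 0) (x h) = D" "d (x h) (x 0) = D" by (simp_all add: x_def D_def d_sym)
  then have gp0: "?gp w (x 0) (x h) = 0" "?gp w (x h) (x n) = 0"
    using dw by (simp_all add: gromov_product_def of_nat_diff)
  define R where "R = real k * \<delta> + 1"
  have near: "real (d (x j) w) \<le> R" if "?gp w (x j) (x (Suc j)) \<le> real k * \<delta>" for j
    using that x_step[of j] d_triangle[OF xV xV wV, of j "Suc j"]
    by (simp add: gromov_product_def R_def)
  have hk: "h \<le> 2 ^ k" "1 \<le> n - h" "n - h \<le> 2 ^ k" using nk h by auto
  obtain i where i: "i < h" "real (d (x i) w) \<le> R"
    using gromov_product_chain[where x = x and i = 0, OF hyp \<delta> xV wV h(1) hk(1)] gp0(1) near by auto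
  obtain j where j: "h \<le> j" "j < n" "real (d (x j) w) \<le> R"
    using gromov_product_chain[where x = x and i = h, OF hyp \<delta> xV wV hk(2,3)] gp0(2) near h(2) by auto
  have ij: "i < j" "j < n" using i j by auto
  have "d (x i) (x j) \<le> d (x i) w + d (x j) w"
    using d_triangle[OF xV wV xV, of i j] d_sym[of w] by simp
  then have close: "real (d (c i) (c j)) \<le> 2 * R" using i j ij by (simp add: x_id)
  have "D - D div 2 \<le> (h - i) + d (x i) w"
    using dw(2) d_triangle[OF xV xV wV, of h i] x_le[of i "h - i"] i(1) d_sym[of "x h" "x i"] by simp
  then have far1: "D \<le> 2 * (h - i) + 2 * d (x i) w" by linarith
  have "D div 2 \<le> i + d (x i) w"
    using dw(1) d_triangle[OF xV xV wV, of 0 i] x_le[of 0 i] by simp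
  then have far2: "D \<le> 2 * i + 2 * d (x i) w + 1" by linarith
  have "real D \<le> 74 * R + 1"
    using bil[OF ij] far1 far2 close i(2) j(1,2) i(1) by linarith
  \<comment> \<open>Now \<open>h \<le> 18 * D\<close> and \<open>n \<le> 2 * h + 1\<close> give the constant \<open>2664 = 36 * 74\<close>.\<close>
  then show ?thesis using hD h(4) unfolding R_def by linarith
qed

end

section \<open>The characterization of hyperbolicity\<close>

theorem proposition5p1:
  fixes V :: "'a set" and E :: "'a set set"
  assumes "connected_graph V E"
  shows "gromov_hyperbolic (realization V E) (graph_dist E) \<longleftrightarrow>
    (\<exists>N. \<forall>n V' E'. bilipschitz_cyclic_subgraph 18 V E n V' E' \<longrightarrow> n \<le> N)"
proof
  interpret conn_graph V E using assms by unfold_locales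
  assume "gromov_hyperbolic (realization V E) (graph_dist E)"
  then obtain \<delta> where \<delta>: "0 \<le> \<delta>" and hyp:
    "\<And>w x y z. w \<in> V \<Longrightarrow> x \<in> V \<Longrightarrow> y \<in> V \<Longrightarrow> z \<in> V \<Longrightarrow>
      gromov_product (\<lambda>u v. real (d u v)) w x z
      \<ge> min (gromov_product (\<lambda>u v. real (d u v)) w x y) (gromov_product (\<lambda>u v. real (d u v)) w y z) - \<delta>"
    unfolding hyperbolic_iff_vertices unfolding gromov_hyperbolic_def by blast
  define A B where "A = 2664 * \<delta>" and "B = 2664 * \<delta> + 2701"
  show "\<exists>N. \<forall>n V' E'. bilipschitz_cyclic_subgraph 18 V E n V' E' \<longrightarrow> n \<le> N"
  proof (intro exI allI impI)
    fix n V' E' assume cycle: "bilipschitz_cyclic_subgraph 18 V E n V' E'"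
    then have "2 \<le> n" by (simp add: bilipschitz_cyclic_subgraph_def cyclic_graph_def)
    then obtain m where m: "2 ^ m < n" "n \<le> 2 ^ (m + 1)" using ex_power_ivl2[of 2 n] by auto
    have "2 ^ m \<le> real n" using m(1) by (metis less_imp_le of_nat_le_iff of_nat_numeral of_nat_power)
    also have "\<dots> \<le> A * real m + B"
      using hyperbolic_bilipschitz_cycle_bound[OF hyp \<delta> cycle m(2)]
      by (simp add: A_def B_def algebra_simps)
    finally have "real m \<le> 2 * A + 2 * B" using \<delta> by (intro exponent_le_of_power_le_linear) (auto simp: A_def B_def)
    then have "m + 1 \<le> nat \<lceil>2 * A + 2 * B\<rceil> + 1" by linarith
    then have "(2::nat) ^ (m + 1) \<le> 2 ^ (nat \<lceil>2 * A + 2 * B\<rceil> + 1)" by (intro power_increasing) auto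
    then show "n \<le> 2 ^ (nat \<lceil>2 * A + 2 * B\<rceil> + 1)" using m(2) by linarith
  qed
next
  assume "\<exists>N. \<forall>n V' E'. bilipschitz_cyclic_subgraph 18 V E n V' E' \<longrightarrow> n \<le> N"
  then obtain N where N: "\<And>n V' E'. bilipschitz_cyclic_subgraph 18 V E n V' E' \<Longrightarrow> n \<le> N" by blast
  interpret conn_graph V E using assms by unfold_locales
  interpret chord_graph V E "max N 3"
  proof unfold_locales
    show "has_short_chord w" if "closed_walk w" "max N 3 + 1 < length w" for w
      by (rule long_closed_walk_has_short_chord[OF _ _ that]) (use N in \<open>auto intro: max.coboundedI1\<close>)
  qed
  show "gromov_hyperbolic (realization V E) (graph_dist E)"
    unfolding hyperbolic_iff_vertices unfolding gromov_hyperbolic_def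
    using four_point_vertices by (intro exI[of _ "3 * (7 * real morse_const + 3)"]) auto
qed

end
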